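(* Let $\nu$ be a positive integer, and let $N_k = n_k+n_{k+1}+\dots +n_{\nu}$, for $k=1,2,\dots, \nu$. Then, for non-negative integers $L,M$, \begin{align*} \sum_{\substack{i,m,n_1,n_2,\dots,n_\nu\geq 0,\\ i+m\equiv N_1+N_2+\dots +N_\nu\text{ (mod 2)}}} &q^{\frac{m^2+3(i^2+N_1^2+N_2^2+\dots+N_\nu^2)}{2}}{L+M-i\brack L}_{q^3}{L-N_1 \brack i}_{q^3} {3n_\nu \brack m}_{q}\\ &\times{2n_\nu + \frac{i-m-N_1-N_2-\dots-N_\nu}{2}\brack 2n_\nu}_{q^3} \prod_{j=1}^{\nu-1}{i-\sum_{l=1}^{j} N_l+n_j \brack n_j}_{q^3}\\ & = \sum_{j=-\infty}^\infty q^{3{\nu+2 \choose 2}j^2+j}\, \mathcal{S}\left(L,M;\,(\nu+2)j,\,(\nu+1)j;\,q^3\right). \end{align*}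
   Context: Here $|q|<1$, $(a;q)_n=(1-a)(1-aq)\cdots(1-aq^{n-1})$, and ${m+n \brack m}_q = \frac{(q;q)_{m+n}}{(q;q)_m(q;q)_n}$ for $m,n\geq 0$ and $0$ otherwise. The refined $q$-trinomial coefficient (Warnaar) is \[\mathcal{S}(L,M;\,a,b;\,q) := \sum_{n\geq0} q^{n(n+a)} {M+L-a-2n\brack M}_q {M-a+b \brack n}_q {M+a-b \brack n+a}_q.\] *)

theory Defs
  imports "HOL-Analysis.Analysis"
begin

definition qpoch :: "complex \<Rightarrow> complex \<Rightarrow> nat \<Rightarrow> complex" where
  "qpoch a q n = (\<Prod>k<n. 1 - a * q ^ k)"

text \<open>
  The \<open>q\<close>-binomial coefficient with upper entry \<open>A\<close> and lower entry \<open>B\<close>. The entries are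
  integers; with \<open>A = m + n\<close> and \<open>B = m\<close>, the condition \<open>m, n \<ge> 0\<close> is \<open>0 \<le> B \<le> A\<close>, and
  outside this range the value is \<open>0\<close>.
\<close>

definition qbinom :: "int \<Rightarrow> int \<Rightarrow> complex \<Rightarrow> complex" where
  "qbinom A B q =
     (if 0 \<le> B \<and> B \<le> A
      then qpoch q q (nat A) / (qpoch q q (nat B) * qpoch q q (nat (A - B)))
      else 0)"

text \<open>
  The refined \<open>q\<close>-trinomial coefficient. The parameter \<open>a\<close> may be negative, so the exponent
  \<open>n * (n + a)\<close> is an integer; it is negative only if \<open>n + a < 0\<close>, where the last factor is \<open>0\<close>.
  The sum has finitely many nonzero terms, since the second \<open>q\<close>-binomial coefficient vanishes
  for \<open>n > M - a + b\<close>.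
\<close>

definition qtrinom_S :: "int \<Rightarrow> int \<Rightarrow> int \<Rightarrow> int \<Rightarrow> complex \<Rightarrow> complex" where
  "qtrinom_S L M a b q =
     (\<Sum>\<^sub>\<infinity>n::nat. q powi (int n * (int n + a))
        * qbinom (M + L - a - 2 * int n) M q
        * qbinom (M - a + b) (int n) q
        * qbinom (M + a - b) (int n + a) q)"

definition tail_sum :: "nat \<Rightarrow> (nat \<Rightarrow> nat) \<Rightarrow> nat \<Rightarrow> nat" where
  "tail_sum \<nu> n k = (\<Sum>j=k..\<nu>. n j)"

text \<open>
  Index tuples \<open>(i, m, n\<^sub>1, \<dots>, n\<^sub>\<nu>)\<close>; the last \<open>\<nu>\<close> entries form a function on \<open>{1..\<nu>}\<close>
  (extensional, so that every tuple is represented exactly once).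
\<close>

definition index_set :: "nat \<Rightarrow> (nat \<times> nat \<times> (nat \<Rightarrow> nat)) set" where
  "index_set \<nu> =
     {(i, m, n). n \<in> {1..\<nu>} \<rightarrow>\<^sub>E (UNIV :: nat set) \<and>
        (i + m) mod 2 = (\<Sum>k=1..\<nu>. tail_sum \<nu> n k) mod 2}"

text \<open>
  On \<open>index_set \<nu>\<close> both divisions by \<open>2\<close> below are exact. Only finitely many of the terms are
  nonzero: \<open>N\<^sub>1 + i \<le> L\<close> and \<open>m \<le> 3 n\<^sub>\<nu>\<close> on the support.
\<close>

definition lhs_term :: "nat \<Rightarrow> nat \<Rightarrow> nat \<Rightarrow> complex \<Rightarrow> nat \<times> nat \<times> (nat \<Rightarrow> nat) \<Rightarrow> complex" where
  "lhs_term \<nu> L M q = (\<lambda>(i, m, n).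
     let N = tail_sum \<nu> n in
       q ^ ((m\<^sup>2 + 3 * (i\<^sup>2 + (\<Sum>k=1..\<nu>. (N k)\<^sup>2))) div 2)
       * qbinom (int L + int M - int i) (int L) (q ^ 3)
       * qbinom (int L - int (N 1)) (int i) (q ^ 3)
       * qbinom (3 * int (n \<nu>)) (int m) q
       * qbinom (2 * int (n \<nu>) + (int i - int m - (\<Sum>k=1..\<nu>. int (N k))) div 2)
                (2 * int (n \<nu>)) (q ^ 3)
       * (\<Prod>j=1..<\<nu>. qbinom (int i - (\<Sum>l=1..j. int (N l)) + int (n j)) (int (n j)) (q ^ 3)))"

end

theory Submission
  imports Defs "HOL-Computational_Algebra.Polynomial"
begin

text \<open>
  The proof goes through Warnaar's refined q-trinomial coefficients \<open>T(L,M;a,b)\<close>. They obey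
  \<open>\<Sum>\<^sub>i q^(i^2/2) [L+M-i, L] T(L-i,i;a,b) = q^(b^2/2) T(L,M;a+b,b)\<close> and a similar relation
  that produces \<open>S(L,M;a+b,a)\<close>. Both follow from three applications of the q-Pfaff-Saalschuetz sum:
  expand a product of two binomials, carry out the sum over \<open>i\<close>, then carry out the sum over the
  expansion index. One starts from the seed
  \<open>\<Sum>\<^sub>j q^(3j^2/2+j) T(L,M;j,j;q^3) = \<Sum>\<^sub>m q^(m^2/2) [3M, m; q] [2M+(L-m)/2, 2M; q^3]\<close>,
  which the q-Pfaff-Saalschuetz sum reduces to splitting \<open>(-x q^(1/2); q)_(3M)\<close> into three factors
  in base \<open>q^3\<close>. Applying the first relation \<open>\<nu>\<close> times and the second once gives the theorem.
  Square roots of \<open>q\<close> are handled by writing \<open>q = p^2\<close>; \<open>q = 0\<close> is treated separately.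
\<close>

subsection \<open>Sums with finite support\<close>

text \<open>The coefficient 3 binom(\<nu>+2, 2) is a balance of exponents. The seed brings q^(3j^2/2
  + j) with parameters (j, j). Each use of the first relation raises the first parameter by j and
  brings another q^(3j^2/2), so \<nu> uses lead to ((\<nu>+1)j, j) with quadratic part
  3(\<nu>+1)j^2/2. The last relation brings q^(3(\<nu>+1)^2 j^2/2), and the total is
  3(\<nu>+1)(\<nu>+2)j^2/2. The linear term j comes from the seed alone. The obstacle in both
  relations is that the summand over i has two q-factorials depending on i in the numerator and six
  in the denominator, while the Saalschuetz sum allows one and five. Reading that sum backwards, at
  the price of a new index k, restores the right shape. All sums run over the whole of Z, with
  vanishing reciprocals marking the range, so shifts and reflections need no boundary care. Since
  \<open>infsum\<close> of a non-summable family is 0, each interchange is justified by a finite set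
  containing the support.\<close>

lemma infsum_swap_finite_support:
  fixes g :: "'a \<Rightarrow> 'b \<Rightarrow> complex"
  assumes "finite C" and "\<And>x y. x \<in> A \<Longrightarrow> y \<in> B \<Longrightarrow> g x y \<noteq> 0 \<Longrightarrow> (x, y) \<in> C"
  shows "(\<Sum>\<^sub>\<infinity>x\<in>A. \<Sum>\<^sub>\<infinity>y\<in>B. g x y) = (\<Sum>\<^sub>\<infinity>y\<in>B. \<Sum>\<^sub>\<infinity>x\<in>A. g x y)"
proof (rule infsum_swap_banach, rule finite_nonzero_values_imp_summable_on)
  show "finite {z \<in> A \<times> B. (case z of (x, y) \<Rightarrow> g x y) \<noteq> 0}"
    by (rule finite_subset[OF _ assms(1)]) (use assms(2) in auto)
qed

lemma infsum_Sigma_finite_support: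
  fixes g :: "'a \<Rightarrow> 'b \<Rightarrow> complex"
  assumes "finite C" and "\<And>x y. x \<in> A \<Longrightarrow> y \<in> B x \<Longrightarrow> g x y \<noteq> 0 \<Longrightarrow> (x, y) \<in> C"
  shows "(\<Sum>\<^sub>\<infinity>x\<in>A. \<Sum>\<^sub>\<infinity>y\<in>B x. g x y) = (\<Sum>\<^sub>\<infinity>(x, y)\<in>Sigma A B. g x y)"
proof (rule infsum_Sigma'_banach, rule finite_nonzero_values_imp_summable_on)
  show "finite {z \<in> Sigma A B. (case z of (x, y) \<Rightarrow> g x y) \<noteq> 0}"
    by (rule finite_subset[OF _ assms(1)]) (use assms(2) in auto)
qed

lemma infsum_single:
  fixes g :: "'a \<Rightarrow> complex"
  assumes "a \<in> A" and "\<And>x. x \<in> A \<Longrightarrow> x \<noteq> a \<Longrightarrow> g x = 0"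
  shows "(\<Sum>\<^sub>\<infinity>x\<in>A. g x) = g a"
proof -
  have "(\<Sum>\<^sub>\<infinity>x\<in>A. g x) = (\<Sum>\<^sub>\<infinity>x\<in>{a}. g x)"
    by (rule infsum_cong_neutral) (use assms in auto)
  thus ?thesis by simp
qed

lemma infsum_int_shift:
  fixes g :: "int \<Rightarrow> complex"
  shows "(\<Sum>\<^sub>\<infinity>x. g (x + c)) = (\<Sum>\<^sub>\<infinity>x. g x)"
  by (rule infsum_reindex_bij_witness[where i = "\<lambda>x. x - c" and j = "\<lambda>x. x + c"]) auto

lemma infsum_int_reflect:
  fixes g :: "int \<Rightarrow> complex"
  shows "(\<Sum>\<^sub>\<infinity>x. g (c - x)) = (\<Sum>\<^sub>\<infinity>x. g x)"
  by (rule infsum_reindex_bij_witness[where i = "\<lambda>x. c - x" and j = "\<lambda>x. c - x"]) auto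

lemma infsum_nonzeroD:
  assumes "(\<Sum>\<^sub>\<infinity>x\<in>A. f x) \<noteq> 0"
  obtains x where "x \<in> A" "f x \<noteq> 0"
  using assms infsum_0[of A f] by blast

text \<open>Links the parity condition, stated for the sum of the N_k, with the exponent, which
  contains the sum of their squares: this is what makes its division by 2 exact.\<close>

lemma even_sum_squares:
  fixes f :: "'a \<Rightarrow> nat"
  shows "even (\<Sum>k\<in>A. (f k)\<^sup>2) = even (\<Sum>k\<in>A. f k)"
  by (induction A rule: infinite_finite_induct) auto

subsection \<open>q-factorials\<close>

text \<open>At negative arguments \<open>nat\<close> gives the default value 1. The recurrence
  therefore fails there, and a product with such a factor is meaningful only if some
  \<open>qr\<close> makes it vanish.\<close>

definition qf :: "complex \<Rightarrow> int \<Rightarrow> complex" where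
  "qf q n = qpoch q q (nat n)"

text \<open>With reciprocals vanishing on negative integers, a q-binomial coefficient is a product of
  three factors without a case distinction.\<close>

definition qr :: "complex \<Rightarrow> int \<Rightarrow> complex" where
  "qr q n = (if n < 0 then 0 else inverse (qf q n))"

lemma qr_neg [simp]: "n < 0 \<Longrightarrow> qr q n = 0"
  by (simp add: qr_def)

lemma qr_nonzeroD: "qr q n \<noteq> 0 \<Longrightarrow> 0 \<le> n"
  by (rule ccontr) simp

lemma qf_0 [simp]: "qf q 0 = 1" and qr_0 [simp]: "qr q 0 = 1"
  by (simp_all add: qf_def qr_def qpoch_def)

locale q_base =
  fixes q :: complex
  assumes q_nz: "q \<noteq> 0" and q_lt: "norm q < 1"
begin

abbreviation F where "F \<equiv> qf q"
abbreviation R where "R \<equiv> qr q"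
abbreviation B where "B \<equiv> \<lambda>A k. qbinom A k q"

lemma F_nonzero: "F n \<noteq> 0"
proof -
  have "1 - q * q ^ k \<noteq> 0" for k
  proof
    assume "1 - q * q ^ k = 0"
    hence "norm (q ^ Suc k) = 1" by simp
    moreover have "norm (q ^ Suc k) < 1"
      using q_lt by (simp only: norm_power) (rule power_Suc_less_one, use q_nz in auto)
    ultimately show False by simp
  qed
  thus ?thesis by (simp add: qf_def qpoch_def)
qed

lemma FR: "0 \<le> n \<Longrightarrow> F n * R n = 1"
  using F_nonzero by (simp add: qr_def)

lemma F_Suc: "0 \<le> n \<Longrightarrow> F (n + 1) = F n * (1 - q powi (n + 1))"
  using q_nz by (simp add: qf_def qpoch_def nat_add_distrib power_int_add power_int_nonneg_exp mult.commute)

text \<open>Valid on all of Z: at n = -1 the factor 1 - q^0 is 0 and matches the vanishing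
  reciprocal. This is why reciprocals need no range conditions.\<close>

lemma R_Suc: "R n = R (n + 1) * (1 - q powi (n + 1))"
proof (cases "0 \<le> n")
  case True
  have "1 - q powi (n + 1) \<noteq> 0"
    using F_Suc[OF True] F_nonzero[of "n + 1"] by auto
  thus ?thesis using True by (simp add: qr_def F_Suc)
next
  case False
  thus ?thesis by (cases "n = -1") auto
qed

lemma B_FR: "B A k = F A * R k * R (A - k)"
proof (cases "0 \<le> k \<and> k \<le> A")
  case True
  thus ?thesis by (simp add: qbinom_def qr_def qf_def divide_inverse)
next
  case False
  hence "k < 0 \<or> A - k < 0" by auto
  thus ?thesis using False by (auto simp: qbinom_def)
qed

lemma B_nonzeroD: "B A k \<noteq> 0 \<Longrightarrow> 0 \<le> k \<and> k \<le> A"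
  by (auto simp: qbinom_def split: if_splits)

lemma B_sym: "B A (A - k) = B A k"
  by (simp add: B_FR)

lemma B_0 [simp]: "0 \<le> A \<Longrightarrow> B A 0 = 1"
  by (simp add: B_FR FR)

lemma B_0_left: "B 0 k = (if k = 0 then 1 else 0)"
  by (auto simp: qbinom_def qpoch_def)

lemma powi_add: "q powi (m + n) = q powi m * q powi n"
  using q_nz by (simp add: power_int_add)

section \<open>The q-Pascal, q-Vandermonde and q-Pfaff-Saalschuetz identities\<close>

lemma B_Suc:
  assumes "0 \<le> A"
  shows "B (A + 1) k = B A k + q powi (A + 1 - k) * B A (k - 1)"
proof -
  have 1: "q powi (A + 1) = q powi (A + 1 - k) * q powi k"
    by (simp flip: powi_add)
  have "R (k - 1) = R k * (1 - q powi k)" and "R (A - k) = R (A + 1 - k) * (1 - q powi (A + 1 - k))"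
    using R_Suc[of "k - 1"] R_Suc[of "A - k"] by (simp_all add: algebra_simps)
  thus ?thesis
    using assms by (simp add: B_FR F_Suc 1) (simp add: algebra_simps)
qed

text \<open>The q-Pascal rule splits the second binomial; the part with lower entry j - 1 is the
  same sum at t - 1, shifted by one in j. The two parts recombine by the q-Pascal rule for the
  right-hand side, so t must stay general in the induction.\<close>

lemma vandermonde_nat:
  assumes "0 \<le> A"
  shows "(\<Sum>\<^sub>\<infinity>j. q powi (j * (A - t + j)) * B A (t - j) * B (int n) j) = B (A + int n) t"
proof (induction n arbitrary: t)
  case 0
  show ?case by (subst infsum_single[where a = 0]) (auto simp: B_0_left)
next
  case (Suc n)
  define f where "f t j = q powi (j * (A - t + j)) * B A (t - j) * B (int n) j" for t j
  have fin: "finite {j \<in> UNIV. f t j \<noteq> 0}" for t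
    by (rule finite_subset[of _ "{0..int n}"]) (auto simp: f_def dest: B_nonzeroD)
  have sm: "f t summable_on UNIV" for t
    using fin by (rule finite_nonzero_values_imp_summable_on)
  have eq: "q powi (j * (A - t + j)) * B A (t - j) * B (int (Suc n)) j
       = f t j + q powi (A + int n + 1 - t) * f (t - 1) (j - 1)" for j
  proof -
    have "q powi (j * (A - t + j)) * q powi (int n + 1 - j) =
          q powi (A + int n + 1 - t) * q powi ((j - 1) * (A - (t - 1) + (j - 1)))"
      by (simp flip: powi_add) (simp add: algebra_simps)
    moreover have "B (int (Suc n)) j = B (int n) j + q powi (int n + 1 - j) * B (int n) (j - 1)"
      using B_Suc[of "int n" j] by (simp add: add.commute)
    ultimately show ?thesis
      by (simp add: f_def distrib_left mult_ac)
  qed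
  have sm': "(\<lambda>j. f (t - 1) (j - 1)) summable_on UNIV"
    by (rule finite_nonzero_values_imp_summable_on, rule finite_subset[of _ "{1..int n + 1}"])
      (auto simp: f_def dest: B_nonzeroD)
  have "(\<Sum>\<^sub>\<infinity>j. q powi (j * (A - t + j)) * B A (t - j) * B (int (Suc n)) j)
      = (\<Sum>\<^sub>\<infinity>j. f t j) + (\<Sum>\<^sub>\<infinity>j. q powi (A + int n + 1 - t) * f (t - 1) (j - 1))"
    unfolding eq by (intro infsum_add sm summable_on_cmult_right sm')
  also have "\<dots> = B (A + int n) t + q powi (A + int n + 1 - t) * (\<Sum>\<^sub>\<infinity>j. f (t - 1) (j - 1))"
    using Suc.IH[of t] by (simp add: f_def infsum_cmult_right')
  also have "(\<Sum>\<^sub>\<infinity>j. f (t - 1) (j - 1)) = B (A + int n) (t - 1)"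
    using infsum_int_shift[of "f (t - 1)" "-1"] Suc.IH[of "t - 1"] by (simp add: f_def)
  also have "B (A + int n) t + q powi (A + int n + 1 - t) * B (A + int n) (t - 1) = B (A + int (Suc n)) t"
    using B_Suc[of "A + int n" t] assms by (simp add: add_ac)
  finally show ?case .
qed

lemma vandermonde:
  assumes "0 \<le> A" "0 \<le> C"
  shows "(\<Sum>\<^sub>\<infinity>j. q powi (j * (A - t + j)) * B A (t - j) * B C j) = B (A + C) t"
  using vandermonde_nat[OF assms(1), of t "nat C"] assms(2) by simp

text \<open>Three q-Vandermonde sums: [a+s, t] is expanded over j, then, after [s, j][b+t, s] =
  [b+t, j][b+t-j, s-j], the last factor is expanded over k. With the order exchanged, the sum over j
  is again a q-Vandermonde sum and yields [a+b+k, k].\<close>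

lemma saalschuetz_binomial:
  assumes "0 \<le> a" "0 \<le> b" "0 \<le> s" "0 \<le> t"
  shows "(\<Sum>\<^sub>\<infinity>k. q powi ((t - k) * (s - k)) * B a (t - k) * B b (s - k) * B (a + b + k) k)
       = B (a + s) t * B (b + t) s"
proof -
  define g where "g j k = q powi (j * (a - t + j)) * q powi ((t - k) * (s - k)) *
      (B a (t - k) * B (a - t + k) (k - j)) * B (b + t) j * B b (s - k)" for j k
  have 1: "B s j * B (b + t) s = B (b + t) j * B (b + t - j) (s - j)" for j
  proof (cases "0 \<le> j \<and> j \<le> s \<and> s \<le> b + t")
    case True
    hence "F s * R s = 1" "F (b + t - j) * R (b + t - j) = 1"
      using assms by (auto intro!: FR)
    thus ?thesis by (simp add: B_FR algebra_simps)
  qed (auto simp: qbinom_def)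
  have 2: "B a (t - j) * B (t - j) (k - j) = B a (t - k) * B (a - t + k) (k - j)" for j k
  proof (cases "t - j \<le> a \<and> j \<le> k \<and> k \<le> t")
    case True
    thus ?thesis using FR[of "t - j"] FR[of "a - t + k"] by (simp add: B_FR algebra_simps)
  qed (auto simp: qbinom_def)
  have 3: "B (b + t - j) (s - j) = (\<Sum>\<^sub>\<infinity>k. q powi ((t - k) * (s - k)) * B (t - j) (k - j) * B b (s - k))"
    if "j \<le> t" for j
    using vandermonde[of "t - j" b "s - j"] that assms
      infsum_int_reflect[of "\<lambda>i. q powi (i * (t - j - (s - j) + i)) * B (t - j) (s - j - i) * B b i" s]
    by (simp add: algebra_simps)
  have "B (a + s) t * B (b + t) s
      = (\<Sum>\<^sub>\<infinity>j. q powi (j * (a - t + j)) * B a (t - j) * (B s j * B (b + t) s))"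
    by (subst vandermonde[symmetric]) (use assms in \<open>simp_all flip: infsum_cmult_left' mult.assoc\<close>)
  also have "\<dots> = (\<Sum>\<^sub>\<infinity>j. \<Sum>\<^sub>\<infinity>k. g j k)"
  proof (rule infsum_cong)
    fix j
    show "q powi (j * (a - t + j)) * B a (t - j) * (B s j * B (b + t) s) = (\<Sum>\<^sub>\<infinity>k. g j k)"
    proof (cases "j \<le> t")
      case True
      show ?thesis
        unfolding 1 3[OF True] g_def
        by (simp flip: infsum_cmult_right' infsum_cmult_left' 2 add: mult_ac)
    next
      case False
      hence "g j k = 0" for k
        using 2[of j k] by (simp add: g_def qbinom_def)
      thus ?thesis using False by (simp add: qbinom_def)
    qed
  qed
  also have "\<dots> = (\<Sum>\<^sub>\<infinity>k. \<Sum>\<^sub>\<infinity>j. g j k)"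
    by (rule infsum_swap_finite_support[where C = "{0..b + t} \<times> {0..b + t + a}"])
       (use assms in \<open>auto simp: g_def qbinom_def split: if_splits\<close>)
  also have "\<dots> = (\<Sum>\<^sub>\<infinity>k. q powi ((t - k) * (s - k)) * B a (t - k) * B b (s - k) * B (a + b + k) k)"
  proof (rule infsum_cong)
    fix k
    show "(\<Sum>\<^sub>\<infinity>j. g j k) = q powi ((t - k) * (s - k)) * B a (t - k) * B b (s - k) * B (a + b + k) k"
    proof (cases "t - k \<le> a")
      case True
      have "(\<Sum>\<^sub>\<infinity>j. g j k) = q powi ((t - k) * (s - k)) * B a (t - k) * B b (s - k) *
          (\<Sum>\<^sub>\<infinity>j. q powi (j * (a - t + k - k + j)) * B (a - t + k) (k - j) * B (b + t) j)"
        by (simp add: g_def mult_ac flip: infsum_cmult_right')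
      also have "\<dots> = q powi ((t - k) * (s - k)) * B a (t - k) * B b (s - k) * B (a - t + k + (b + t)) k"
        by (subst vandermonde) (use True assms in auto)
      finally show ?thesis
        by (simp add: algebra_simps)
    qed (simp add: g_def qbinom_def)
  qed
  finally show ?thesis ..
qed

text \<open>No positivity assumption: both sides vanish unless all \<open>x\<^sub>i + y\<^sub>j\<close> are nonnegative.\<close>

lemma saalschuetz:
  "(\<Sum>\<^sub>\<infinity>k. q powi ((x1 - k) * (x2 - k)) * F (x1 + x2 + y1 + y2 + y3 + k) *
        R (x1 - k) * R (x2 - k) * R (y1 + k) * R (y2 + k) * R (y3 + k))
   = F (x1 + x2 + y1 + y2) * F (x1 + x2 + y1 + y3) * F (x1 + x2 + y2 + y3) *
     R (x1 + y1) * R (x1 + y2) * R (x1 + y3) * R (x2 + y1) * R (x2 + y2) * R (x2 + y3)"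
    (is "(\<Sum>\<^sub>\<infinity>k. ?f k) = ?r")
proof (cases "0 \<le> x1 + y1 \<and> 0 \<le> x1 + y2 \<and> 0 \<le> x1 + y3 \<and> 0 \<le> x2 + y1 \<and> 0 \<le> x2 + y2 \<and> 0 \<le> x2 + y3")
  case True
  \<comment> \<open>Shifting \<open>k\<close> by \<open>y1\<close> turns \<open>y1 + k\<close> into
    the lower entry k of the last binomial. The reciprocals with x1, y2 then pair up over the upper
    entry a, those with x2, y3 over b.\<close>
  define a b s t where "a = x1 + y2" and "b = x2 + y3" and "s = x2 + y1" and "t = x1 + y1"
  have nn: "0 \<le> a" "0 \<le> b" "0 \<le> s" "0 \<le> t"
    using True by (auto simp: a_def b_def s_def t_def)
  have "(\<Sum>\<^sub>\<infinity>k. ?f k) = (\<Sum>\<^sub>\<infinity>k. ?f (k - y1))"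
    using infsum_int_shift[of ?f "- y1"] by simp
  also have "\<dots> = (\<Sum>\<^sub>\<infinity>k. (q powi ((t - k) * (s - k)) * B a (t - k) * B b (s - k) * B (a + b + k) k) *
                       (R a * R b * F (a + b)))"
  proof (rule infsum_cong)
    fix k
    \<comment> \<open>Factors equal to 1 supply the numerators and denominators missing from the
      three binomials.\<close>
    have "?f (k - y1) = ?f (k - y1) * (F a * R a) * (F b * R b) * (F (a + b) * R (a + b))"
      using nn by (simp add: FR)
    also have "\<dots> = (q powi ((t - k) * (s - k)) * B a (t - k) * B b (s - k) * B (a + b + k) k) *
                       (R a * R b * F (a + b))"
      by (simp add: B_FR a_def b_def s_def t_def algebra_simps)
    finally show "?f (k - y1) = \<dots>" .
  qed
  also have "\<dots> = B (a + s) t * B (b + t) s * (R a * R b * F (a + b))"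
    by (subst saalschuetz_binomial[OF nn, symmetric]) (simp add: infsum_cmult_left')
  also have "\<dots> = ?r"
    by (simp add: B_FR a_def b_def s_def t_def algebra_simps)
  finally show ?thesis .
next
  case False
  have "?f k = 0" for k
  proof (rule ccontr)
    assume "?f k \<noteq> 0"
    hence "0 \<le> x1 - k" "0 \<le> x2 - k" "0 \<le> y1 + k" "0 \<le> y2 + k" "0 \<le> y3 + k"
      by (auto dest: qr_nonzeroD)
    thus False using False by linarith
  qed
  hence "(\<Sum>\<^sub>\<infinity>k. ?f k) = 0" by (simp only: infsum_0_simp)
  moreover have "?r = 0" using False by force
  ultimately show ?thesis by simp
qed

end

subsection \<open>Warnaar's transformations of refined q-trinomial coefficients\<close>

text \<open>This is Warnaar's other refined q-trinomial coefficient, in base \<open>s\<^sup>2\<close>. His summation variable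
  is \<open>n = L - a - 2r\<close>; summing over \<open>r\<close> avoids the parity condition and the half-integral
  exponents.\<close>

definition qtrinom_T :: "complex \<Rightarrow> int \<Rightarrow> int \<Rightarrow> int \<Rightarrow> int \<Rightarrow> complex" where
  "qtrinom_T s L M a b =
     (\<Sum>\<^sub>\<infinity>r. s powi ((L - a - 2 * r)\<^sup>2) * qbinom M (L - a - 2 * r) (s\<^sup>2) *
          qbinom (M + b + r) r (s\<^sup>2) * qbinom (M - b + r + a) (r + a) (s\<^sup>2))"

locale s_base =
  fixes s :: complex
  assumes s_nz: "s \<noteq> 0" and s_lt: "norm s < 1"
begin

sublocale q_base "s\<^sup>2"
  by unfold_locales (use s_nz s_lt in \<open>auto simp: norm_power power_less_one_iff\<close>)

lemma s_powi_add: "s powi (m + n) = s powi m * s powi n"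
  using s_nz by (simp add: power_int_add)

lemma s2_powi: "s\<^sup>2 powi n = s powi (2 * n)"
  by (simp add: power_int_power)

text \<open>Cancels a q-factorial against its reciprocal although n may be negative: off the range
  the remaining factor \<open>x\<close> must vanish anyway.\<close>

lemma FR_cancel: "(x \<noteq> 0 \<Longrightarrow> 0 \<le> n) \<Longrightarrow> x * (F n * R n) = x"
  by (cases "x = 0") (simp_all add: FR)

abbreviation T where "T \<equiv> qtrinom_T s"

text \<open>The shift r = \<rho> - i frees \<open>F (\<rho> + b)\<close>,
  \<open>F (\<rho> + a - b)\<close> and \<open>R (2 * \<rho> + a - L)\<close> from i; the only
  numerator still depending on i is \<open>F i\<close>.\<close>

lemma T_shifted:
  "T (L - i) i a b = (\<Sum>\<^sub>\<infinity>\<rho>. s powi ((L + i - a - 2 * \<rho>)\<^sup>2) *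
     (F i * R (L + i - a - 2 * \<rho>) * R (2 * \<rho> + a - L)) *
     (F (\<rho> + b) * R (\<rho> - i) * R (i + b)) *
     (F (\<rho> + a - b) * R (\<rho> + a - i) * R (i - b)))"
  unfolding qtrinom_T_def
  by (subst infsum_int_shift[symmetric, where c = "-i"])
     (auto simp: B_FR algebra_simps intro!: infsum_cong)

text \<open>The hypothesis \<open>b \<le> a\<close> is essential: if \<open>L - \<rho> < b\<close>, the right-hand side is \<open>0\<close>, but without it
  the left-hand side need not be.\<close>

lemma product_expansion:
  assumes "0 \<le> b" "b \<le> a" and e: "e = 2 * \<rho> + a - L"
  shows "R (\<rho> - i) * (F i * R (i - e) * R e) * (F (\<rho> + a - b) * R (\<rho> + a - i) * R (i - b)) =
     (\<Sum>\<^sub>\<infinity>k. R (\<rho> - i) * F b * F (L - \<rho> - b) * R (L - \<rho>) * (s\<^sup>2 powi ((e - k) * (i - b - k)) *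
        F (L - \<rho> + k) * R (e - k) * R (i - b - k) * R k * R (b - e + k) * R (L - \<rho> - i + k)))"
proof -
  have "(\<Sum>\<^sub>\<infinity>k. R (\<rho> - i) * F b * F (L - \<rho> - b) * R (L - \<rho>) * (s\<^sup>2 powi ((e - k) * (i - b - k)) *
        F (L - \<rho> + k) * R (e - k) * R (i - b - k) * R k * R (b - e + k) * R (L - \<rho> - i + k)))
     = R (\<rho> - i) * F b * F (L - \<rho> - b) * R (L - \<rho>) * (F i * F (\<rho> + a - b) * F (L - \<rho>) *
        R e * R b * R (\<rho> + a - i) * R (i - b) * R (i - e) * R (L - \<rho> - b))"
    \<comment> \<open>Arguments chosen so that the product side contains \<open>F i\<close> and
      \<open>F (\<rho> + a - b)\<close>; its surplus factors are the pairs at b, L - \<rho> and L -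
      \<rho> - b, which cancel.\<close>
    using saalschuetz[of e "i - b" 0 "b - e" "L - \<rho> - i"]
    unfolding infsum_cmult_right' by (simp add: e algebra_simps)
  also have "\<dots> = R (\<rho> - i) * (F i * R (i - e) * R e) * (F (\<rho> + a - b) * R (\<rho> + a - i) * R (i - b))
      * (F b * R b) * (F (L - \<rho>) * R (L - \<rho>)) * (F (L - \<rho> - b) * R (L - \<rho> - b))"
    by (simp add: mult_ac)
  also have "\<dots> = R (\<rho> - i) * (F i * R (i - e) * R e) * (F (\<rho> + a - b) * R (\<rho> + a - i) * R (i - b))"
    by (subst FR_cancel, use assms in \<open>force dest!: qr_nonzeroD\<close>)+ simp
  finally show ?thesis ..
qed

text \<open>After \<open>product_expansion\<close>, i enters only through reciprocals, a power of s
  and the weight \<open>c i\<close>. Replacing \<rho> by D = \<rho> - k makes the reciprocal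
  \<open>R (L - D - i)\<close> independent of k. A weight with one q-factorial over another then
  gives the inner sum the one-over-five Saalschuetz shape. The weight stays general so that both
  relations can share the expansion.\<close>

lemma sum_T_expansion:
  fixes c :: "int \<Rightarrow> complex" and a b L :: int
  assumes "0 \<le> b" "b \<le> a"
  defines "w \<equiv> \<lambda>D. 2 * D + a - L"
  shows "(\<Sum>\<^sub>\<infinity>i. c i * T (L - i) i a b) = (\<Sum>\<^sub>\<infinity>D. \<Sum>\<^sub>\<infinity>k.
      s powi ((w D)\<^sup>2 - 2 * w D * b + 2 * k * (w D + k - b)) *
      (F b * F (D + k + b) * F (L - D - k - b) * F (L - D) *
       R (w D + k) * R (b - w D - k) * R k * R (L - D - k)) *
      (\<Sum>\<^sub>\<infinity>i. c i * (s powi (i\<^sup>2 - 2 * i * k) *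
          R (D + k - i) * R (i + b) * R (i - b - k) * R (L - D - i))))"
proof -
  define Z where "Z i D k =
      s powi ((w D)\<^sup>2 - 2 * w D * b + 2 * k * (w D + k - b)) *
      (F b * F (D + k + b) * F (L - D - k - b) * F (L - D) *
       R (w D + k) * R (b - w D - k) * R k * R (L - D - k)) *
      (c i * (s powi (i\<^sup>2 - 2 * i * k) *
          R (D + k - i) * R (i + b) * R (i - b - k) * R (L - D - i)))" for i D k
  have Z_support: "0 \<le> k \<and> k \<le> i \<and> i \<le> D + k \<and> D + k \<le> L" if "Z i D k \<noteq> 0" for i D k
    using that assms(1) by (auto simp: Z_def dest!: qr_nonzeroD)
  have 1: "c i * T (L - i) i a b = (\<Sum>\<^sub>\<infinity>\<rho>. \<Sum>\<^sub>\<infinity>k. Z i (\<rho> - k) k)" for i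
    unfolding T_shifted infsum_cmult_right'[symmetric]
  proof (rule infsum_cong)
    fix \<rho>
    define e where "e = 2 * \<rho> + a - L"
    define y where "y = c i * s powi ((L + i - a - 2 * \<rho>)\<^sup>2) * (F (\<rho> + b) * R (i + b))"
    have "c i * (s powi ((L + i - a - 2 * \<rho>)\<^sup>2) *
        (F i * R (L + i - a - 2 * \<rho>) * R (2 * \<rho> + a - L)) *
        (F (\<rho> + b) * R (\<rho> - i) * R (i + b)) *
        (F (\<rho> + a - b) * R (\<rho> + a - i) * R (i - b)))
      = y * (R (\<rho> - i) * (F i * R (i - e) * R e) *
           (F (\<rho> + a - b) * R (\<rho> + a - i) * R (i - b)))"
      by (simp add: y_def e_def algebra_simps)
    also have "\<dots> = (\<Sum>\<^sub>\<infinity>k. Z i (\<rho> - k) k)"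
      unfolding product_expansion[OF assms(1,2) e_def] infsum_cmult_right'[symmetric]
    proof (rule infsum_cong)
      fix k
      have we: "w (\<rho> - k) = e - 2 * k" by (simp add: w_def e_def)
      have "s powi ((L + i - a - 2 * \<rho>)\<^sup>2) * s\<^sup>2 powi ((e - k) * (i - b - k)) =
            s powi ((w (\<rho> - k))\<^sup>2 - 2 * w (\<rho> - k) * b + 2 * k * (w (\<rho> - k) + k - b)) *
            s powi (i\<^sup>2 - 2 * i * k)"
        unfolding s2_powi we by (simp flip: s_powi_add) (simp add: e_def power2_eq_square algebra_simps)
      thus "y * (R (\<rho> - i) * F b * F (L - \<rho> - b) * R (L - \<rho>) * (s\<^sup>2 powi ((e - k) * (i - b - k)) *
        F (L - \<rho> + k) * R (e - k) * R (i - b - k) * R k * R (b - e + k) * R (L - \<rho> - i + k)))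
        = Z i (\<rho> - k) k"
        unfolding Z_def y_def we by (simp add: algebra_simps)
    qed
    finally show "c i * (s powi ((L + i - a - 2 * \<rho>)\<^sup>2) *
        (F i * R (L + i - a - 2 * \<rho>) * R (2 * \<rho> + a - L)) *
        (F (\<rho> + b) * R (\<rho> - i) * R (i + b)) *
        (F (\<rho> + a - b) * R (\<rho> + a - i) * R (i - b))) = (\<Sum>\<^sub>\<infinity>k. Z i (\<rho> - k) k)" .
  qed
  have 2: "(\<Sum>\<^sub>\<infinity>\<rho>. \<Sum>\<^sub>\<infinity>k. Z i (\<rho> - k) k) = (\<Sum>\<^sub>\<infinity>D. \<Sum>\<^sub>\<infinity>k. Z i D k)" for i
  proof -
    have "(\<Sum>\<^sub>\<infinity>\<rho>. \<Sum>\<^sub>\<infinity>k. Z i (\<rho> - k) k) = (\<Sum>\<^sub>\<infinity>k. \<Sum>\<^sub>\<infinity>\<rho>. Z i (\<rho> - k) k)"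
      by (rule infsum_swap_finite_support[where C = "{0..L} \<times> {0..L}"]) (auto dest!: Z_support)
    also have "\<dots> = (\<Sum>\<^sub>\<infinity>k. \<Sum>\<^sub>\<infinity>D. Z i D k)"
      using infsum_int_shift[of "\<lambda>D. Z i D k" "- k" for k] by simp
    also have "\<dots> = (\<Sum>\<^sub>\<infinity>D. \<Sum>\<^sub>\<infinity>k. Z i D k)"
      by (rule infsum_swap_finite_support[where C = "{0..L} \<times> {-L..L}"]) (auto dest!: Z_support)
    finally show ?thesis .
  qed
  have "(\<Sum>\<^sub>\<infinity>i. c i * T (L - i) i a b) = (\<Sum>\<^sub>\<infinity>i. \<Sum>\<^sub>\<infinity>D. \<Sum>\<^sub>\<infinity>k. Z i D k)"
    by (simp only: 1 2)
  also have "\<dots> = (\<Sum>\<^sub>\<infinity>D. \<Sum>\<^sub>\<infinity>i. \<Sum>\<^sub>\<infinity>k. Z i D k)"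
    by (rule infsum_swap_finite_support[where C = "{0..L} \<times> {-L..L}"])
       (auto elim!: infsum_nonzeroD dest!: Z_support)
  also have "\<dots> = (\<Sum>\<^sub>\<infinity>D. \<Sum>\<^sub>\<infinity>k. \<Sum>\<^sub>\<infinity>i. Z i D k)"
    by (intro infsum_cong infsum_swap_finite_support[where C = "{0..L} \<times> {0..L}"])
       (auto dest!: Z_support)
  finally show ?thesis
    by (simp only: Z_def infsum_cmult_right')
qed

text \<open>Saalschuetz evaluates the sum over i, which leaves a sum over k that is again of
  Saalschuetz type for each D. What survives is a single sum over D.\<close>

theorem T_transform_nonneg:
  assumes "0 \<le> b" "b \<le> a" "0 \<le> L"
  shows "(\<Sum>\<^sub>\<infinity>i. s powi (i\<^sup>2) * B (L + M - i) L * T (L - i) i a b) = s powi (b\<^sup>2) * T L M (a + b) b"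
proof -
  define w where "w D = 2 * D + a - L" for D
  have 1: "(\<Sum>\<^sub>\<infinity>i. s powi (i\<^sup>2) * B (L + M - i) L * (s powi (i\<^sup>2 - 2 * i * k) *
          R (D + k - i) * R (i + b) * R (i - b - k) * R (L - D - i)))
      = s powi (2 * b\<^sup>2 + 2 * b * k) * R L * (F (M + D) * F (M + L - D - k) * F L *
        R (M + b) * R (D + k + b) * R (L - D + b) * R (M - b - k) * R (D - b) * R (L - D - k - b))"
    (is "(\<Sum>\<^sub>\<infinity>i. ?f i) = _") for D k
  proof -
    \<comment> \<open>The numerator is the q-factorial of L + M - i, whereas
      \<open>saalschuetz\<close> has the index with a plus sign; hence the reflection.\<close>
    have "(\<Sum>\<^sub>\<infinity>i. ?f i) = (\<Sum>\<^sub>\<infinity>i. ?f (- i))"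
      using infsum_int_reflect[of ?f 0] by simp
    also have "\<dots> = (\<Sum>\<^sub>\<infinity>i. s powi (2 * b\<^sup>2 + 2 * b * k) * R L *
        (s\<^sup>2 powi ((b - i) * (- b - k - i)) * F (b + (- b - k) + M + (D + k) + (L - D) + i) *
         R (b - i) * R (- b - k - i) * R (M + i) * R (D + k + i) * R (L - D + i)))"
    proof (rule infsum_cong)
      fix i
      have "s powi ((- i)\<^sup>2) * s powi ((- i)\<^sup>2 - 2 * (- i) * k) =
            s powi (2 * b\<^sup>2 + 2 * b * k) * s\<^sup>2 powi ((b - i) * (- b - k - i))"
        unfolding s2_powi by (simp flip: s_powi_add) (simp add: power2_eq_square algebra_simps)
      moreover have idx: "- i - (b + k) = - b - (i + k)" by simp
      ultimately show "?f (- i) = s powi (2 * b\<^sup>2 + 2 * b * k) * R L *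
        (s\<^sup>2 powi ((b - i) * (- b - k - i)) * F (b + (- b - k) + M + (D + k) + (L - D) + i) *
         R (b - i) * R (- b - k - i) * R (M + i) * R (D + k + i) * R (L - D + i))"
        by (simp add: B_FR algebra_simps idx)
    qed
    also have "\<dots> = s powi (2 * b\<^sup>2 + 2 * b * k) * R L * (F (M + D) * F (M + L - D - k) * F L *
        R (M + b) * R (D + k + b) * R (L - D + b) * R (M - b - k) * R (D - b) * R (L - D - k - b))"
      unfolding infsum_cmult_right' saalschuetz by (simp add: algebra_simps)
    finally show ?thesis .
  qed
  have 2: "(\<Sum>\<^sub>\<infinity>k. s powi ((w D)\<^sup>2 - 2 * w D * b + 2 * k * (w D + k - b)) *
      (F b * F (D + k + b) * F (L - D - k - b) * F (L - D) *
       R (w D + k) * R (b - w D - k) * R k * R (L - D - k)) *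
      (s powi (2 * b\<^sup>2 + 2 * b * k) * R L * (F (M + D) * F (M + L - D - k) * F L *
        R (M + b) * R (D + k + b) * R (L - D + b) * R (M - b - k) * R (D - b) * R (L - D - k - b))))
      = s powi (b\<^sup>2) * (s powi ((L - (a + b) - 2 * (D - b))\<^sup>2) * B M (L - (a + b) - 2 * (D - b)) *
          B (M + b + (D - b)) (D - b) * B (M - b + (D - b) + (a + b)) (D - b + (a + b)))"
    (is "(\<Sum>\<^sub>\<infinity>k. ?g k) = ?rhs") for D
  proof -
    define C where "C = s powi ((w D)\<^sup>2 - 2 * w D * b + 2 * b\<^sup>2) *
        (F b * F (L - D) * F (M + D) * R (M + b) * R (L - D + b) * R (D - b))"
    have "?g k = C * (s\<^sup>2 powi ((0 + k) * (w D + k)) *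
        F (0 + w D + (M - b) + (b - w D) + (L - D) - k) *
        R (0 + k) * R (w D + k) * R (M - b - k) * R (b - w D - k) * R (L - D - k))" for k
    proof -
      define y where "y = s powi ((w D)\<^sup>2 - 2 * w D * b + 2 * k * (w D + k - b)) * s powi (2 * b\<^sup>2 + 2 * b * k)
        * F b * F (L - D) * R (w D + k) * R (b - w D - k) * R k * R (L - D - k) * F (M + D) *
        F (M + L - D - k) * R (M + b) * R (L - D + b) * R (M - b - k) * R (D - b)"
      \<comment> \<open>The second bound is where b \<le> a enters: b - w D - k \<ge> 0 says L - D -
        k - b \<ge> (D - b) + (a - b).\<close>
      have y_support: "0 \<le> D + k + b \<and> 0 \<le> L - D - k - b" if "y \<noteq> 0"
      proof -
        have "0 \<le> b - w D - k" "0 \<le> k" "0 \<le> D - b"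
          using that by (auto simp: y_def dest!: qr_nonzeroD)
        thus ?thesis using assms by (simp add: w_def)
      qed
      have "?g k = y * (F (D + k + b) * R (D + k + b)) * (F (L - D - k - b) * R (L - D - k - b)) * (F L * R L)"
        by (simp add: y_def mult_ac)
      also have "\<dots> = y"
        using assms y_support by (subst FR_cancel, force)+ simp
      also have "s powi ((w D)\<^sup>2 - 2 * w D * b + 2 * k * (w D + k - b)) * s powi (2 * b\<^sup>2 + 2 * b * k) =
           s powi ((w D)\<^sup>2 - 2 * w D * b + 2 * b\<^sup>2) * s\<^sup>2 powi ((0 + k) * (w D + k))"
        unfolding s2_powi by (simp flip: s_powi_add) (simp add: power2_eq_square algebra_simps)
      hence "y = C * (s\<^sup>2 powi ((0 + k) * (w D + k)) *
        F (0 + w D + (M - b) + (b - w D) + (L - D) - k) *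
        R (0 + k) * R (w D + k) * R (M - b - k) * R (b - w D - k) * R (L - D - k))"
        by (simp add: y_def C_def algebra_simps)
      finally show ?thesis .
    qed
    hence "(\<Sum>\<^sub>\<infinity>k. ?g k) = C * (\<Sum>\<^sub>\<infinity>k. s\<^sup>2 powi ((0 + k) * (w D + k)) *
        F (0 + w D + (M - b) + (b - w D) + (L - D) - k) *
        R (0 + k) * R (w D + k) * R (M - b - k) * R (b - w D - k) * R (L - D - k))"
      by (simp only: infsum_cmult_right')
    also have "\<dots> = C * (F (w D + (M - b) + (b - w D)) * F (w D + (M - b) + (L - D)) *
        F (w D + (b - w D) + (L - D)) * R (M - b) * R (b - w D) * R (L - D) * R (w D + (M - b)) *
        R (w D + (b - w D)) * R (w D + (L - D)))"
      using saalschuetz[of 0 "w D" "M - b" "b - w D" "L - D"]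
        infsum_int_reflect[of "\<lambda>k. s\<^sup>2 powi ((0 - k) * (w D - k)) *
        F (0 + w D + (M - b) + (b - w D) + (L - D) + k) *
        R (0 - k) * R (w D - k) * R (M - b + k) * R (b - w D + k) * R (L - D + k)" 0]
      by simp
    also have "\<dots> = ?rhs"
    proof -
      define y where "y = s powi ((w D)\<^sup>2 - 2 * w D * b + 2 * b\<^sup>2) * F M * F (M + D) * R (M + b) * R (D - b)
        * F (w D + (M - b) + (L - D)) * R (M - b) * R (b - w D) * R (w D + (M - b)) * R (w D + (L - D))"
      have y_support: "0 \<le> L - D" if "y \<noteq> 0"
      proof -
        have "0 \<le> b - w D" "0 \<le> D - b"
          using that by (auto simp: y_def dest!: qr_nonzeroD)
        thus ?thesis using assms by (simp add: w_def)
      qed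
      have "C * (F (w D + (M - b) + (b - w D)) * F (w D + (M - b) + (L - D)) *
        F (w D + (b - w D) + (L - D)) * R (M - b) * R (b - w D) * R (L - D) * R (w D + (M - b)) *
        R (w D + (b - w D)) * R (w D + (L - D)))
        = y * (F (L - D) * R (L - D)) * (F (L - D + b) * R (L - D + b)) * (F b * R b)"
        by (simp add: y_def C_def algebra_simps)
      also have "\<dots> = y"
        using assms y_support by (subst FR_cancel, force)+ simp
      also have "s powi ((w D)\<^sup>2 - 2 * w D * b + 2 * b\<^sup>2) =
          s powi (b\<^sup>2) * s powi ((L - (a + b) - 2 * (D - b))\<^sup>2)"
        by (simp flip: s_powi_add) (simp add: power2_eq_square algebra_simps w_def)
      hence "y = ?rhs"
        by (simp add: y_def B_FR w_def algebra_simps)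
      finally show ?thesis .
    qed
    finally show ?thesis .
  qed
  \<comment> \<open>D - b is the summation index of \<open>T L M (a + b) b\<close>.\<close>
  show ?thesis
    unfolding sum_T_expansion[OF assms(1,2)] 1 w_def[symmetric] 2
    using infsum_int_shift[of "\<lambda>D. s powi ((L - (a + b) - 2 * D)\<^sup>2) * B M (L - (a + b) - 2 * D) *
          B (M + b + D) D * B (M - b + D + (a + b)) (D + (a + b))" "-b"]
    by (simp add: qtrinom_T_def infsum_cmult_right')
qed

lemma qtrinom_S_int_sum:
  "qtrinom_S L M a b (s\<^sup>2) = (\<Sum>\<^sub>\<infinity>n::int. s\<^sup>2 powi (n * (n + a)) * B (M + L - a - 2 * n) M *
     B (M - a + b) n * B (M + a - b) (n + a))"
  unfolding qtrinom_S_def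
proof -
  have "(\<Sum>\<^sub>\<infinity>n::nat. s\<^sup>2 powi (int n * (int n + a)) * B (M + L - a - 2 * int n) M *
     B (M - a + b) (int n) * B (M + a - b) (int n + a)) =
     (\<Sum>\<^sub>\<infinity>n\<in>{0..}. s\<^sup>2 powi (n * (n + a)) * B (M + L - a - 2 * n) M *
     B (M - a + b) n * B (M + a - b) (n + a))"
    by (rule infsum_reindex_bij_witness[where i = nat and j = int]) auto
  also have "\<dots> = (\<Sum>\<^sub>\<infinity>n. s\<^sup>2 powi (n * (n + a)) * B (M + L - a - 2 * n) M *
     B (M - a + b) n * B (M + a - b) (n + a))"
    by (rule infsum_cong_neutral) (auto simp: qbinom_def)
  finally show "(\<Sum>\<^sub>\<infinity>n::nat. s\<^sup>2 powi (int n * (int n + a)) * B (M + L - a - 2 * int n) M *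
     B (M - a + b) (int n) * B (M + a - b) (int n + a)) = \<dots>" .
qed

theorem S_transform_nonneg:
  assumes "0 \<le> b" "b \<le> a" "0 \<le> L"
  shows "(\<Sum>\<^sub>\<infinity>i. s powi ((L - i)\<^sup>2) * B (M + i) L * T (L - i) i a b) =
    s powi (a\<^sup>2) * qtrinom_S L M (a + b) a (s\<^sup>2)"
proof -
  define w where "w D = 2 * D + a - L" for D
  have 1: "(\<Sum>\<^sub>\<infinity>i. s powi ((L - i)\<^sup>2) * B (M + i) L * (s powi (i\<^sup>2 - 2 * i * k) *
          R (D + k - i) * R (i + b) * R (i - b - k) * R (L - D - i)))
      = s powi (L\<^sup>2 - 2 * (D + k) * (L - D)) * R L * (F (M + b + k) * F (M - b) * F L *
        R (M - L + D + k) * R (D + k + b) * R (D - b) * R (M - D) * R (L - D + b) * R (L - D - k - b))"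
    (is "(\<Sum>\<^sub>\<infinity>i. ?f i) = _") for D k
  proof -
    have "(\<Sum>\<^sub>\<infinity>i. ?f i) = (\<Sum>\<^sub>\<infinity>i. s powi (L\<^sup>2 - 2 * (D + k) * (L - D)) * R L *
        (s\<^sup>2 powi ((D + k - i) * (L - D - i)) * F (D + k + (L - D) + (M - L) + b + (- b - k) + i) *
         R (D + k - i) * R (L - D - i) * R (M - L + i) * R (b + i) * R (- b - k + i)))"
    proof (rule infsum_cong)
      fix i
      have "s powi ((L - i)\<^sup>2) * s powi (i\<^sup>2 - 2 * i * k) =
            s powi (L\<^sup>2 - 2 * (D + k) * (L - D)) * s\<^sup>2 powi ((D + k - i) * (L - D - i))"
        unfolding s2_powi by (simp flip: s_powi_add) (simp add: power2_eq_square algebra_simps)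
      thus "?f i = s powi (L\<^sup>2 - 2 * (D + k) * (L - D)) * R L *
        (s\<^sup>2 powi ((D + k - i) * (L - D - i)) * F (D + k + (L - D) + (M - L) + b + (- b - k) + i) *
         R (D + k - i) * R (L - D - i) * R (M - L + i) * R (b + i) * R (- b - k + i))"
        by (simp add: B_FR algebra_simps)
    qed
    also have "\<dots> = s powi (L\<^sup>2 - 2 * (D + k) * (L - D)) * R L * (F (M + b + k) * F (M - b) * F L *
        R (M - L + D + k) * R (D + k + b) * R (D - b) * R (M - D) * R (L - D + b) * R (L - D - k - b))"
      unfolding infsum_cmult_right' saalschuetz by (simp add: algebra_simps)
    finally show ?thesis .
  qed
  have 2: "(\<Sum>\<^sub>\<infinity>k. s powi ((w D)\<^sup>2 - 2 * w D * b + 2 * k * (w D + k - b)) *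
      (F b * F (D + k + b) * F (L - D - k - b) * F (L - D) *
       R (w D + k) * R (b - w D - k) * R k * R (L - D - k)) *
      (s powi (L\<^sup>2 - 2 * (D + k) * (L - D)) * R L * (F (M + b + k) * F (M - b) * F L *
        R (M - L + D + k) * R (D + k + b) * R (D - b) * R (M - D) * R (L - D + b) * R (L - D - k - b))))
      = s powi (a\<^sup>2) * (s\<^sup>2 powi ((D - b) * (D - b + (a + b))) * B (M + L - (a + b) - 2 * (D - b)) M *
          B (M - (a + b) + a) (D - b) * B (M + (a + b) - a) (D - b + (a + b)))"
    (is "(\<Sum>\<^sub>\<infinity>k. ?g k) = ?rhs") for D
  proof -
    \<comment> \<open>The part of the exponent free of k once 2(b - w D - k)(L - D - k) has been
      split off.\<close>
    define E where "E = (w D)\<^sup>2 - 2 * w D * b + L\<^sup>2 - 2 * D * (L - D) - 2 * (b - w D) * (L - D)"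
    define C where "C = s powi E * (F b * F (L - D) * F (M - b) * R (D - b) * R (M - D) * R (L - D + b))"
    have "?g k = C * (s\<^sup>2 powi ((b - w D - k) * (L - D - k)) *
        F (b - w D + (L - D) + 0 + w D + (M - L + D) + k) *
        R (b - w D - k) * R (L - D - k) * R (0 + k) * R (w D + k) * R (M - L + D + k))" for k
    proof -
      define y where "y = s powi ((w D)\<^sup>2 - 2 * w D * b + 2 * k * (w D + k - b)) *
        s powi (L\<^sup>2 - 2 * (D + k) * (L - D)) *
        F b * F (L - D) * R (w D + k) * R (b - w D - k) * R k * R (L - D - k) * F (M - b) *
        F (M + b + k) * R (M - L + D + k) * R (L - D + b) * R (M - D) * R (D - b)"
      have y_support: "0 \<le> D + k + b \<and> 0 \<le> L - D - k - b" if "y \<noteq> 0"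
      proof -
        have "0 \<le> b - w D - k" "0 \<le> k" "0 \<le> D - b"
          using that by (auto simp: y_def dest!: qr_nonzeroD)
        thus ?thesis using assms by (simp add: w_def)
      qed
      have "?g k = y * (F (D + k + b) * R (D + k + b)) * (F (L - D - k - b) * R (L - D - k - b)) * (F L * R L)"
        by (simp add: y_def mult_ac)
      also have "\<dots> = y"
        using assms y_support by (subst FR_cancel, force)+ simp
      also have "s powi ((w D)\<^sup>2 - 2 * w D * b + 2 * k * (w D + k - b)) * s powi (L\<^sup>2 - 2 * (D + k) * (L - D)) =
           s powi E * s\<^sup>2 powi ((b - w D - k) * (L - D - k))"
        unfolding s2_powi E_def
        by (simp flip: s_powi_add) (simp add: power2_eq_square algebra_simps)
      hence "y = C * (s\<^sup>2 powi ((b - w D - k) * (L - D - k)) *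
        F (b - w D + (L - D) + 0 + w D + (M - L + D) + k) *
        R (b - w D - k) * R (L - D - k) * R (0 + k) * R (w D + k) * R (M - L + D + k))"
        by (simp add: y_def C_def algebra_simps)
      finally show ?thesis .
    qed
    hence "(\<Sum>\<^sub>\<infinity>k. ?g k) = C * (\<Sum>\<^sub>\<infinity>k. s\<^sup>2 powi ((b - w D - k) * (L - D - k)) *
        F (b - w D + (L - D) + 0 + w D + (M - L + D) + k) *
        R (b - w D - k) * R (L - D - k) * R (0 + k) * R (w D + k) * R (M - L + D + k))"
      by (simp only: infsum_cmult_right')
    also have "\<dots> = C * (F (b + (L - D)) * F (M + b - w D) * F (M + b) *
        R (b - w D) * R b * R (M - L + D + (b - w D)) * R (L - D) * R (w D + (L - D)) * R M)"
      unfolding saalschuetz by (simp add: algebra_simps)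
    also have "\<dots> = ?rhs"
    proof -
      define y where "y = s powi E * F (M - b) * R (D - b) * R (M - D) * F (M + b - w D) * F (M + b) *
        R (b - w D) * R (M - L + D + (b - w D)) * R (w D + (L - D)) * R M"
      have y_support: "0 \<le> L - D" if "y \<noteq> 0"
      proof -
        have "0 \<le> b - w D" "0 \<le> D - b"
          using that by (auto simp: y_def dest!: qr_nonzeroD)
        thus ?thesis using assms by (simp add: w_def)
      qed
      have "C * (F (b + (L - D)) * F (M + b - w D) * F (M + b) *
        R (b - w D) * R b * R (M - L + D + (b - w D)) * R (L - D) * R (w D + (L - D)) * R M)
        = y * (F (L - D) * R (L - D)) * (F (L - D + b) * R (L - D + b)) * (F b * R b)"
        by (simp add: y_def C_def algebra_simps)
      also have "\<dots> = y"
        using assms y_support by (subst FR_cancel, force)+ simp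
      also have "s powi E = s powi (a\<^sup>2) * s\<^sup>2 powi ((D - b) * (D - b + (a + b)))"
        unfolding s2_powi E_def
        by (simp flip: s_powi_add) (simp add: power2_eq_square algebra_simps w_def)
      hence "y = ?rhs"
        by (simp add: y_def B_FR w_def algebra_simps)
      finally show ?thesis .
    qed
    finally show ?thesis .
  qed
  show ?thesis
    unfolding sum_T_expansion[OF assms(1,2)] 1 w_def[symmetric] 2
    using infsum_int_shift[of "\<lambda>n. s\<^sup>2 powi (n * (n + (a + b))) * B (M + L - (a + b) - 2 * n) M *
          B (M - (a + b) + a) n * B (M + (a + b) - a) (n + (a + b))" "-b"]
    by (simp add: qtrinom_S_int_sum infsum_cmult_right')
qed

text \<open>Shifting the index by a exchanges the last two binomials. With \<open>S_neg\<close> this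
  carries both relations over to negative j.\<close>

lemma T_neg: "T L M (- a) (- b) = T L M a b"
proof -
  define f where "f r = s powi ((L - a - 2 * r)\<^sup>2) * B M (L - a - 2 * r) * B (M + b + r) r *
    B (M - b + r + a) (r + a)" for r
  have "T L M (- a) (- b) = (\<Sum>\<^sub>\<infinity>r. f (r + - a))"
    unfolding qtrinom_T_def
    by (rule infsum_cong) (simp add: f_def algebra_simps)
  also have "\<dots> = T L M a b"
    unfolding infsum_int_shift[of f] by (simp add: qtrinom_T_def f_def[abs_def])
  finally show ?thesis .
qed

lemma S_neg: "qtrinom_S L M (- a) (- b) (s\<^sup>2) = qtrinom_S L M a b (s\<^sup>2)"
proof -
  define f where "f n = s\<^sup>2 powi (n * (n + a)) * B (M + L - a - 2 * n) M * B (M - a + b) n *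
    B (M + a - b) (n + a)" for n
  have "qtrinom_S L M (- a) (- b) (s\<^sup>2) = (\<Sum>\<^sub>\<infinity>n. f (n + - a))"
    unfolding qtrinom_S_int_sum
    by (rule infsum_cong) (simp add: f_def algebra_simps)
  also have "\<dots> = qtrinom_S L M a b (s\<^sup>2)"
    unfolding infsum_int_shift[of f] by (simp add: qtrinom_S_int_sum f_def[abs_def])
  finally show ?thesis .
qed

text \<open>For c \<ge> 0, the parameters (c+1)j and j have the same sign and the first is at least
  as large in absolute value, so up to a sign change 0 \<le> b \<le> a holds.\<close>

corollary T_transform:
  assumes "0 \<le> c" "0 \<le> L"
  shows "(\<Sum>\<^sub>\<infinity>i. s powi (i\<^sup>2) * B (L + M - i) L * T (L - i) i ((c + 1) * j) j) =
     s powi (j\<^sup>2) * T L M ((c + 2) * j) j"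
proof -
  have sum_eq: "(c + 1) * j + j = (c + 2) * j" and neg_eq: "- ((c + 1) * j) - j = - ((c + 2) * j)"
    by (simp_all add: algebra_simps)
  show ?thesis
  proof (cases "0 \<le> j")
    case True
    hence "j \<le> (c + 1) * j" using assms by (simp add: distrib_right)
    from T_transform_nonneg[OF True this assms(2)] show ?thesis by (simp add: sum_eq)
  next
    case False
    hence "- j \<le> (c + 1) * (- j)" "0 \<le> - j" using assms by (auto simp: distrib_right mult_nonneg_nonpos)
    from T_transform_nonneg[OF this(2,1) assms(2)]
    have "(\<Sum>\<^sub>\<infinity>i. s powi (i\<^sup>2) * B (L + M - i) L * T (L - i) i (- ((c + 1) * j)) (- j)) =
       s powi (j\<^sup>2) * T L M (- ((c + 2) * j)) (- j)"
      using sum_eq by (simp add: neg_eq)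
    thus ?thesis unfolding T_neg by simp
  qed
qed

corollary S_transform:
  assumes "0 \<le> c" "0 \<le> L"
  shows "(\<Sum>\<^sub>\<infinity>i. s powi ((L - i)\<^sup>2) * B (M + i) L * T (L - i) i ((c + 1) * j) j) =
     s powi (((c + 1) * j)\<^sup>2) * qtrinom_S L M ((c + 2) * j) ((c + 1) * j) (s\<^sup>2)"
proof -
  have sum_eq: "(c + 1) * j + j = (c + 2) * j" and neg_eq: "- ((c + 1) * j) - j = - ((c + 2) * j)"
    by (simp_all add: algebra_simps)
  show ?thesis
  proof (cases "0 \<le> j")
    case True
    hence "j \<le> (c + 1) * j" using assms by (simp add: distrib_right)
    from S_transform_nonneg[OF True this assms(2)] show ?thesis by (simp add: sum_eq)
  next
    case False
    hence "- j \<le> (c + 1) * (- j)" "0 \<le> - j" using assms by (auto simp: distrib_right mult_nonneg_nonpos)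
    from S_transform_nonneg[OF this(2,1) assms(2)]
    have "(\<Sum>\<^sub>\<infinity>i. s powi ((L - i)\<^sup>2) * B (M + i) L * T (L - i) i (- ((c + 1) * j)) (- j)) =
       s powi ((- ((c + 1) * j))\<^sup>2) * qtrinom_S L M (- ((c + 2) * j)) (- ((c + 1) * j)) (s\<^sup>2)"
      using sum_eq by (simp add: neg_eq)
    thus ?thesis unfolding T_neg S_neg by simp
  qed
qed

text \<open>The bounds on \<open>b\<close> make the sums over j finite, since j stands in that place
  throughout.\<close>

lemma T_nonzeroD:
  assumes "T L M a b \<noteq> 0"
  shows "0 \<le> L" "0 \<le> M" "- M \<le> b" "b \<le> M"
proof -
  obtain r where r: "B M (L - a - 2 * r) * B (M + b + r) r * B (M - b + r + a) (r + a) \<noteq> 0"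
    using infsum_nonzeroD[OF assms[unfolded qtrinom_T_def]] by (metis mult.assoc mult_zero_right)
  thus "0 \<le> L" "0 \<le> M" "- M \<le> b" "b \<le> M"
    by (auto dest!: B_nonzeroD)
qed

text \<open>The finite q-binomial theorem in base \<open>s\<^sup>2\<close>, with the variable scaled
  by s so that the exponent binom(m, 2) + m/2 becomes the pure square m^2/2.\<close>

lemma coeff_prod_linear:
  "coeff (\<Prod>i<n. [:1, z * s ^ (2 * i + 1):]) m = z ^ m * s ^ m\<^sup>2 * B (int n) (int m)"
proof (induction n arbitrary: m)
  case 0
  show ?case by (cases m) (auto simp: B_0_left)
next
  case (Suc n)
  define G where "G = (\<Prod>i<n. [:1, z * s ^ (2 * i + 1):])"
  have G: "(\<Prod>i<Suc n. [:1, z * s ^ (2 * i + 1):]) = G + pCons 0 (smult (z * s ^ (2 * n + 1)) G)"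
    by (simp add: G_def mult.commute[of "prod _ _"])
  show ?case
  proof (cases m)
    case 0
    thus ?thesis using Suc.IH[of 0] by (simp add: G flip: G_def)
  next
    case (Suc k)
    have "s ^ (2 * n + 1) * s ^ k\<^sup>2 * B (int n) (int k) =
          s ^ m\<^sup>2 * (s\<^sup>2 powi (int n - int k) * B (int n) (int k))"
    proof (cases "k \<le> n")
      case True
      have "2 * n + 1 + k\<^sup>2 = m\<^sup>2 + 2 * (n - k)"
        using True by (simp add: Suc power2_eq_square)
      hence "s ^ (2 * n + 1) * s ^ k\<^sup>2 = s ^ m\<^sup>2 * (s\<^sup>2) ^ (n - k)"
        by (metis power_add power_mult)
      thus ?thesis using True by (simp flip: of_nat_diff)
    qed (simp add: qbinom_def)
    moreover have "B (int (Suc n)) (int m) = B (int n) (int m) + s\<^sup>2 powi (int n - int k) * B (int n) (int k)"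
      using B_Suc[of "int n" "int m"] by (simp add: Suc algebra_simps)
    ultimately show ?thesis
      using Suc.IH[of m] Suc.IH[of k] by (simp add: G Suc flip: G_def) (simp add: algebra_simps)
  qed
qed

end

subsection \<open>The seed identity\<close>

text \<open>Extension by zero to Z turns the Cauchy product into an unrestricted sum.\<close>

definition int_coeff :: "complex poly \<Rightarrow> int \<Rightarrow> complex" where
  "int_coeff f m = (if m < 0 then 0 else coeff f (nat m))"

lemma int_coeff_mult: "int_coeff (f * g) m = (\<Sum>\<^sub>\<infinity>i. int_coeff f i * int_coeff g (m - i))"
proof (cases "0 \<le> m")
  case True
  have "int_coeff (f * g) m = (\<Sum>i\<le>nat m. coeff f i * coeff g (nat m - i))"
    using True by (simp add: int_coeff_def coeff_mult)
  also have "\<dots> = (\<Sum>i\<in>{0..m}. int_coeff f i * int_coeff g (m - i))"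
    by (rule sum.reindex_bij_witness[where i = nat and j = int])
       (use True in \<open>auto simp: int_coeff_def nat_diff_distrib\<close>)
  also have "\<dots> = (\<Sum>\<^sub>\<infinity>i\<in>{0..m}. int_coeff f i * int_coeff g (m - i))"
    by simp
  also have "\<dots> = (\<Sum>\<^sub>\<infinity>i. int_coeff f i * int_coeff g (m - i))"
    by (rule infsum_cong_neutral) (auto simp: int_coeff_def)
  finally show ?thesis .
next
  case False
  have "int_coeff f i * int_coeff g (m - i) = 0" for i
    using False by (auto simp: int_coeff_def)
  hence "(\<Sum>\<^sub>\<infinity>i. int_coeff f i * int_coeff g (m - i)) = 0"
    by (simp only: infsum_0_simp)
  thus ?thesis using False by (simp add: int_coeff_def)
qed

text \<open>\<open>p\<close> and \<open>P\<close> are square roots of the two bases q and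
  q^3.\<close>

locale cubic_base =
  fixes p P :: complex
  assumes p_nz: "p \<noteq> 0" and p_lt: "norm p < 1" and P_eq: "P = p ^ 3"
begin

sublocale one: s_base p
  by unfold_locales (rule p_nz p_lt)+

sublocale three: s_base P
  by unfold_locales (use p_nz p_lt in \<open>auto simp: P_eq norm_power power_less_one_iff\<close>)

abbreviation B1 where "B1 \<equiv> \<lambda>A k. qbinom A k (p\<^sup>2)"
abbreviation B3 where "B3 \<equiv> \<lambda>A k. qbinom A k (P\<^sup>2)"
abbreviation T3 where "T3 \<equiv> qtrinom_T P"

lemma p3_powi: "P powi n = p powi (3 * n)" and p6_powi: "P\<^sup>2 powi n = p powi (6 * n)"
  by (simp_all add: P_eq power_int_power flip: power_mult)

text \<open>Compare coefficients of X^m after sorting the factors 1 + p^(2j+1) X by j mod 3. The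
  residues 0, 1, 2 give products in base q^3 with offsets p^(-2), 1 and p^2, which is the source of
  the term 2(u - v).\<close>

lemma trisection:
  "p powi (m\<^sup>2) * B1 (3 * int M) m =
    (\<Sum>\<^sub>\<infinity>v. \<Sum>\<^sub>\<infinity>u. p powi (2 * (u - v) + 3 * (u\<^sup>2 + v\<^sup>2 + (m - v - u)\<^sup>2)) *
        (B3 (int M) v * B3 (int M) u * B3 (int M) (m - v - u)))"
proof -
  define G where "G z n = (\<Prod>i<n. [:1, z * P ^ (2 * i + 1):])" for z n
  have split: "(\<Prod>i<3 * n. [:1, 1 * p ^ (2 * i + 1):]) = G (inverse (p\<^sup>2)) n * (G (p\<^sup>2) n * G 1 n)" for n
  proof (induction n)
    case (Suc n)
    have "3 * Suc n = Suc (Suc (Suc (3 * n)))" by simp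
    moreover have "inverse (p\<^sup>2) * P ^ (2 * n + 1) = p ^ (2 * (3 * n) + 1)"
      "p\<^sup>2 * P ^ (2 * n + 1) = p ^ (2 * (3 * n + 2) + 1)"
      "P ^ (2 * n + 1) = p ^ (2 * (3 * n + 1) + 1)"
      using p_nz unfolding P_eq power_mult[symmetric] by (simp_all add: field_simps power_add eval_nat_numeral)
    ultimately show ?case
      using Suc.IH unfolding G_def by (simp only: prod.lessThan_Suc mult_ac mult_1 mult_1_right) (simp add: add_ac)
  qed (simp add: G_def)
  have coeff_G: "int_coeff (G (p powi z) n) m = p powi (z * m + 3 * m\<^sup>2) * B3 (int n) m" for z n m
  proof (cases "0 \<le> m")
    case True
    hence "(p powi z) ^ nat m * P ^ (nat m)\<^sup>2 = p powi (z * m + 3 * m\<^sup>2)"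
      using p_nz by (simp add: one.s_powi_add power_int_power' flip: p3_powi)
        (simp add: power_int_nonneg_exp nat_power_eq)
    thus ?thesis using True unfolding int_coeff_def G_def three.coeff_prod_linear by simp
  qed (simp add: int_coeff_def qbinom_def)
  have "p powi (m\<^sup>2) * B1 (3 * int M) m = int_coeff (\<Prod>i<3 * M. [:1, 1 * p ^ (2 * i + 1):]) m"
    unfolding int_coeff_def one.coeff_prod_linear
    by (auto simp: qbinom_def power_int_nonneg_exp nat_power_eq)
  also have "\<dots> = int_coeff (G (p powi (-2)) M * (G (p powi 2) M * G (p powi 0) M)) m"
    unfolding split by (simp add: power_int_minus)
  also have "\<dots> = (\<Sum>\<^sub>\<infinity>v. \<Sum>\<^sub>\<infinity>u. p powi (-2 * v + 3 * v\<^sup>2) * B3 (int M) v *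
      (p powi (2 * u + 3 * u\<^sup>2) * B3 (int M) u * (p powi (0 * (m - v - u) + 3 * (m - v - u)\<^sup>2) * B3 (int M) (m - v - u))))"
    unfolding int_coeff_mult coeff_G infsum_cmult_right' ..
  also have "\<dots> = (\<Sum>\<^sub>\<infinity>v. \<Sum>\<^sub>\<infinity>u. p powi (2 * (u - v) + 3 * (u\<^sup>2 + v\<^sup>2 + (m - v - u)\<^sup>2)) *
        (B3 (int M) v * B3 (int M) u * B3 (int M) (m - v - u)))"
  proof (intro infsum_cong)
    fix v u
    have "p powi (2 * (u - v) + 3 * (u\<^sup>2 + v\<^sup>2 + (m - v - u)\<^sup>2)) =
      p powi (-2 * v + 3 * v\<^sup>2) * p powi (2 * u + 3 * u\<^sup>2) * p powi (0 * (m - v - u) + 3 * (m - v - u)\<^sup>2)"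
      by (simp flip: one.s_powi_add) (simp add: algebra_simps)
    thus "p powi (-2 * v + 3 * v\<^sup>2) * B3 (int M) v *
      (p powi (2 * u + 3 * u\<^sup>2) * B3 (int M) u * (p powi (0 * (m - v - u) + 3 * (m - v - u)\<^sup>2) * B3 (int M) (m - v - u)))
      = p powi (2 * (u - v) + 3 * (u\<^sup>2 + v\<^sup>2 + (m - v - u)\<^sup>2)) *
        (B3 (int M) v * B3 (int M) u * B3 (int M) (m - v - u))"
      by (simp only: mult_ac)
  qed
  finally show ?thesis .
qed

text \<open>Here k stands for (L - m)/2, so the parity restriction on m disappears.\<close>

definition seed :: "int \<Rightarrow> int \<Rightarrow> complex" where
  "seed L M = (\<Sum>\<^sub>\<infinity>k. p powi ((L - 2 * k)\<^sup>2) * B1 (3 * M) (L - 2 * k) * B3 (2 * M + k) k)"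

lemma seed_neg: "M < 0 \<Longrightarrow> seed L M = 0"
  by (simp add: seed_def qbinom_def)

text \<open>For a = b = j and t = j + r the last two binomials are [M+t, r][M+r, t], the product
  side of \<open>saalschuetz_binomial\<close>. Its expansion over k, followed by t = u + k and r = v
  + k, decouples the exponent because 3(u - v)^2 + 6uv = 3u^2 + 3v^2, and \<open>trisection\<close>
  sums over u and v.\<close>

lemma seed_identity: "seed L M = (\<Sum>\<^sub>\<infinity>j. p powi (3 * j\<^sup>2 + 2 * j) * T3 L M j j)"
proof (cases "0 \<le> M")
  case False
  have "T3 L M j j = 0" for j
    using False three.T_nonzeroD(2) by blast
  thus ?thesis using False by (simp add: seed_neg)
next
  case True
  define f where "f r t = p powi (3 * (t - r)\<^sup>2 + 2 * (t - r) + 3 * (L - t - r)\<^sup>2) *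
      B3 M (L - t - r) * (B3 (M + t) r * B3 (M + r) t)" for r t
  define g where "g r t k = p powi (3 * (t - r)\<^sup>2 + 2 * (t - r) + 3 * (L - t - r)\<^sup>2 + 6 * ((t - k) * (r - k))) *
      B3 M (L - t - r) * B3 M (t - k) * B3 M (r - k) * B3 (2 * M + k) k" for r t k
  have g_support: "0 \<le> k \<and> k \<le> t \<and> k \<le> r \<and> t \<le> L \<and> r \<le> L" if "g r t k \<noteq> 0" for r t k
    using that unfolding g_def by (auto dest!: three.B_nonzeroD)
  have fg: "f r t = (\<Sum>\<^sub>\<infinity>k. g r t k)" for r t
  proof (cases "0 \<le> r \<and> 0 \<le> t")
    case nn: True
    have "f r t = (\<Sum>\<^sub>\<infinity>k. p powi (3 * (t - r)\<^sup>2 + 2 * (t - r) + 3 * (L - t - r)\<^sup>2) *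
      B3 M (L - t - r) * (P\<^sup>2 powi ((t - k) * (r - k)) * B3 M (t - k) * B3 M (r - k) * B3 (M + M + k) k))"
      unfolding infsum_cmult_right' three.saalschuetz_binomial[OF True True conjunct1[OF nn] conjunct2[OF nn]]
      by (simp add: f_def mult_ac)
    thus ?thesis
      by (simp add: g_def p6_powi one.s_powi_add mult_ac)
  next
    case False
    hence "g r t k = 0" for k using g_support by force
    moreover have "f r t = 0" using False by (auto simp: f_def qbinom_def)
    ultimately show ?thesis by simp
  qed
  have "(\<Sum>\<^sub>\<infinity>j. p powi (3 * j\<^sup>2 + 2 * j) * T3 L M j j) = (\<Sum>\<^sub>\<infinity>j. \<Sum>\<^sub>\<infinity>r. f r (j + r))"
    unfolding qtrinom_T_def infsum_cmult_right'[symmetric]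
    by (intro infsum_cong) (simp add: f_def p3_powi one.s_powi_add algebra_simps)
  also have "\<dots> = (\<Sum>\<^sub>\<infinity>r. \<Sum>\<^sub>\<infinity>j. f r (j + r))"
    by (rule infsum_swap_finite_support[where C = "{- L..L} \<times> {0..L}"])
       (auto simp: f_def dest!: three.B_nonzeroD)
  also have "\<dots> = (\<Sum>\<^sub>\<infinity>r. \<Sum>\<^sub>\<infinity>t. \<Sum>\<^sub>\<infinity>k. g r t k)"
    by (simp only: infsum_int_shift[of "f r" for r] flip: fg)
  also have "\<dots> = (\<Sum>\<^sub>\<infinity>r. \<Sum>\<^sub>\<infinity>k. \<Sum>\<^sub>\<infinity>t. g r t k)"
    by (intro infsum_cong infsum_swap_finite_support[where C = "{0..L} \<times> {0..L}"])
       (auto dest!: g_support)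
  also have "\<dots> = (\<Sum>\<^sub>\<infinity>k. \<Sum>\<^sub>\<infinity>r. \<Sum>\<^sub>\<infinity>t. g r t k)"
    by (rule infsum_swap_finite_support[where C = "{0..L} \<times> {0..L}"])
       (auto elim!: infsum_nonzeroD dest!: g_support)
  also have "\<dots> = (\<Sum>\<^sub>\<infinity>k. \<Sum>\<^sub>\<infinity>v. \<Sum>\<^sub>\<infinity>u. g (v + k) (u + k) k)"
    unfolding infsum_int_shift[of "\<lambda>t. g r t k" k for r k]
      infsum_int_shift[of "\<lambda>r. \<Sum>\<^sub>\<infinity>t. g r t k" k for k] ..
  also have "\<dots> = (\<Sum>\<^sub>\<infinity>k. B3 (2 * M + k) k * (p powi ((L - 2 * k)\<^sup>2) * B1 (3 * int (nat M)) (L - 2 * k)))"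
    unfolding trisection infsum_cmult_right'[symmetric]
  proof (intro infsum_cong)
    fix k v u
    have e1: "3 * (u + k - (v + k))\<^sup>2 + 2 * (u + k - (v + k)) + 3 * (L - (u + k) - (v + k))\<^sup>2 + 6 * ((u + k - k) * (v + k - k))
      = 2 * (u - v) + 3 * (u\<^sup>2 + v\<^sup>2 + (L - 2 * k - v - u)\<^sup>2)"
      by (simp add: power2_eq_square algebra_simps)
    have e2: "L - (u + k) - (v + k) = L - 2 * k - v - u" by simp
    show "g (v + k) (u + k) k = B3 (2 * M + k) k *
        (p powi (2 * (u - v) + 3 * (u\<^sup>2 + v\<^sup>2 + (L - 2 * k - v - u)\<^sup>2)) *
          (B3 (int (nat M)) v * B3 (int (nat M)) u * B3 (int (nat M)) (L - 2 * k - v - u)))"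
      unfolding g_def e1 unfolding e2 using True by (simp add: mult_ac)
  qed
  also have "\<dots> = seed L M"
    using True by (simp add: seed_def mult_ac)
  finally show ?thesis ..
qed

subsection \<open>Iterating the transformation\<close>

text \<open>The bridge between the two sides: \<open>V_eq_T\<close> evaluates it as a sum over j,
  \<open>V_eq_sum_W\<close> unfolds it into a multisum.\<close>

primrec V :: "nat \<Rightarrow> int \<Rightarrow> int \<Rightarrow> complex" where
  "V 0 L M = seed L M"
| "V (Suc n) L M = (\<Sum>\<^sub>\<infinity>i. P powi (i\<^sup>2) * B3 (L + M - i) L * V n (L - i) i)"

lemma V_eq_T: "V n L M = (\<Sum>\<^sub>\<infinity>j. p powi (3 * (int n + 1) * j\<^sup>2 + 2 * j) * T3 L M ((int n + 1) * j) j)"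
proof (induction n arbitrary: L M)
  case 0
  show ?case by (simp add: seed_identity)
next
  case (Suc n)
  show ?case
  proof (cases "0 \<le> L")
    case False
    have "T3 L M a b = 0" for a b
      using False three.T_nonzeroD(1) by blast
    thus ?thesis using False by (simp add: qbinom_def)
  next
    case True
    define \<alpha> where "\<alpha> j = p powi (3 * (int n + 1) * j\<^sup>2 + 2 * j)" for j
    have "V (Suc n) L M = (\<Sum>\<^sub>\<infinity>i. \<Sum>\<^sub>\<infinity>j. P powi (i\<^sup>2) * B3 (L + M - i) L * (\<alpha> j * T3 (L - i) i ((int n + 1) * j) j))"
      unfolding V.simps Suc.IH infsum_cmult_right' \<alpha>_def ..
    also have "\<dots> = (\<Sum>\<^sub>\<infinity>j. \<Sum>\<^sub>\<infinity>i. P powi (i\<^sup>2) * B3 (L + M - i) L * (\<alpha> j * T3 (L - i) i ((int n + 1) * j) j))"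
    proof (rule infsum_swap_finite_support[where C = "{0..M} \<times> {- M..M}"])
      fix i j
      assume "P powi (i\<^sup>2) * B3 (L + M - i) L * (\<alpha> j * T3 (L - i) i ((int n + 1) * j) j) \<noteq> 0"
      hence "B3 (L + M - i) L \<noteq> 0" "T3 (L - i) i ((int n + 1) * j) j \<noteq> 0" by auto
      thus "(i, j) \<in> {0..M} \<times> {- M..M}"
        using three.B_nonzeroD[of "L + M - i" L] three.T_nonzeroD[of "L - i" i "(int n + 1) * j" j] by simp
    qed simp
    also have "\<dots> = (\<Sum>\<^sub>\<infinity>j. \<alpha> j * (\<Sum>\<^sub>\<infinity>i. P powi (i\<^sup>2) * B3 (L + M - i) L * T3 (L - i) i ((int n + 1) * j) j))"
      unfolding infsum_cmult_right'[symmetric] by (simp only: mult_ac)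
    also have "\<dots> = (\<Sum>\<^sub>\<infinity>j. \<alpha> j * (P powi (j\<^sup>2) * T3 L M ((int n + 2) * j) j))"
      by (subst three.T_transform) (use True in auto)
    also have "\<dots> = (\<Sum>\<^sub>\<infinity>j. p powi (3 * (int (Suc n) + 1) * j\<^sup>2 + 2 * j) * T3 L M ((int (Suc n) + 1) * j) j)"
    proof (rule infsum_cong)
      fix j
      have "\<alpha> j * P powi (j\<^sup>2) = p powi (3 * (int (Suc n) + 1) * j\<^sup>2 + 2 * j)"
        by (simp add: \<alpha>_def p3_powi flip: one.s_powi_add) (simp add: algebra_simps)
      moreover have "int n + 2 = int (Suc n) + 1" by simp
      ultimately show "\<alpha> j * (P powi (j\<^sup>2) * T3 L M ((int n + 2) * j) j) =
          p powi (3 * (int (Suc n) + 1) * j\<^sup>2 + 2 * j) * T3 L M ((int (Suc n) + 1) * j) j"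
        by (simp only: mult.assoc[symmetric])
    qed
    finally show ?thesis .
  qed
qed

lemma V_neg: "L < 0 \<Longrightarrow> V n L M = 0"
  unfolding V_eq_T using three.T_nonzeroD(1) by (force intro!: infsum_0)

text \<open>\<open>W n L N\<close> is the summand of the fully unfolded \<open>V n L (N 0)\<close> at the summation
  variables \<open>N 1, \<dots>, N n\<close>.\<close>

primrec W :: "nat \<Rightarrow> int \<Rightarrow> (nat \<Rightarrow> int) \<Rightarrow> complex" where
  "W 0 L N = seed L (N 0)"
| "W (Suc n) L N = P powi ((N 1)\<^sup>2) * B3 (L + N 0 - N 1) L * W n (L - N 1) (\<lambda>k. N (Suc k))"

text \<open>Each step lowers L by the next variable. Passing to the complementary lower entry puts
  the difference \<open>N j - N (Suc j)\<close> at the bottom of the binomial; for j \<ge> 1 this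
  difference is n_j in the theorem.\<close>

lemma W_closed_form:
  "W n L N = P powi (\<Sum>k<n. (N (Suc k))\<^sup>2) * seed (L - (\<Sum>k<n. N (Suc k))) (N n) *
    (\<Prod>j<n. B3 (L - (\<Sum>l<j. N (Suc l)) + (N j - N (Suc j))) (N j - N (Suc j)))"
proof (induction n arbitrary: L N)
  case (Suc n)
  have "B3 (L + (N 0 - N 1)) (N 0 - N 1) = B3 (L + N 0 - N 1) L"
    using three.B_sym[of "L + N 0 - N 1" "N 0 - N 1"] by (simp add: algebra_simps)
  thus ?case
    unfolding W.simps Suc.IH
    by (simp add: sum.lessThan_Suc_shift prod.lessThan_Suc_shift three.s_powi_add diff_diff_eq
          del: sum.lessThan_Suc prod.lessThan_Suc)
qed simp

lemma W_nonzeroD: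
  assumes "W n L N \<noteq> 0"
  shows "0 \<le> N n" "k < n \<Longrightarrow> N (Suc k) \<le> N k"
proof -
  show "0 \<le> N n"
    using assms seed_neg[of "N n"] by (force simp: W_closed_form)
  assume "k < n"
  hence "B3 (L - (\<Sum>l<k. N (Suc l)) + (N k - N (Suc k))) (N k - N (Suc k)) \<noteq> 0"
    using assms by (auto simp: W_closed_form)
  thus "N (Suc k) \<le> N k" by (auto dest: three.B_nonzeroD)
qed

section \<open>From nested sums over N_1, ..., N_\<nu> to the multisum over n_1, ...,
  n_\<nu>\<close>

definition tails :: "int \<Rightarrow> nat \<Rightarrow> (nat \<Rightarrow> nat) \<Rightarrow> nat \<Rightarrow> int" where
  "tails M \<nu> n k = (if k = 0 then M else int (tail_sum \<nu> n k))"

lemma W_tails_nonzeroD: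
  assumes "W \<nu> L (tails M \<nu> n) \<noteq> 0"
  shows "int (tail_sum \<nu> n 1) \<le> M"
proof (cases \<nu>)
  case 0
  thus ?thesis using W_nonzeroD(1)[OF assms] by (simp add: tails_def tail_sum_def)
next
  case (Suc m)
  thus ?thesis using W_nonzeroD(2)[OF assms, of 0] by (simp add: tails_def)
qed

lemma le_tail_sum: "k \<in> {1..\<nu>} \<Longrightarrow> n k \<le> tail_sum \<nu> n 1"
  unfolding tail_sum_def by (rule member_le_sum) auto

text \<open>\<open>W\<close> vanishes unless its variables decrease weakly to a value \<ge> 0, and
  such chains are exactly the tail sums of free nonnegative n_k. The induction prepends one variable
  to the chain.\<close>

lemma V_eq_sum_W: "V \<nu> L M = (\<Sum>\<^sub>\<infinity>n\<in>{1..\<nu>} \<rightarrow>\<^sub>E UNIV. W \<nu> L (tails M \<nu> n))"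
proof (induction \<nu> arbitrary: L M)
  case 0
  show ?case by (simp add: tails_def)
next
  case (Suc \<nu>)
  define h where "h i n = P powi (i\<^sup>2) * B3 (L + M - i) L * W \<nu> (L - i) (tails i \<nu> n)" for i n
  have h_support: "int (tail_sum \<nu> n 1) \<le> i \<and> i \<le> M" if "h i n \<noteq> 0" for i n
    using that W_tails_nonzeroD[of \<nu> "L - i" i n] three.B_nonzeroD[of "L + M - i" L] by (auto simp: h_def)
  have fin: "finite ({1..\<nu>} \<rightarrow>\<^sub>E {..nat M})"
    by (intro finite_PiE) auto
  have dom: "n \<in> {1..\<nu>} \<rightarrow>\<^sub>E {..nat M}" if "n \<in> {1..\<nu>} \<rightarrow>\<^sub>E UNIV" "int (tail_sum \<nu> n 1) \<le> M" for n
  proof (rule PiE_I)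
    fix k assume "k \<in> {1..\<nu>}"
    thus "n k \<in> {..nat M}" using le_tail_sum[of k \<nu> n] that(2) by auto
  qed (rule PiE_arb[OF that(1)])
  have "V (Suc \<nu>) L M = (\<Sum>\<^sub>\<infinity>i. \<Sum>\<^sub>\<infinity>n\<in>{1..\<nu>} \<rightarrow>\<^sub>E UNIV. h i n)"
    unfolding V.simps Suc.IH h_def infsum_cmult_right' ..
  also have "\<dots> = (\<Sum>\<^sub>\<infinity>n\<in>{1..\<nu>} \<rightarrow>\<^sub>E UNIV. \<Sum>\<^sub>\<infinity>i. h i n)"
  proof (rule infsum_swap_finite_support[where C = "{0..M} \<times> ({1..\<nu>} \<rightarrow>\<^sub>E {..nat M})"])
    fix i n
    assume "n \<in> {1..\<nu>} \<rightarrow>\<^sub>E UNIV" "h i n \<noteq> 0"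
    thus "(i, n) \<in> {0..M} \<times> ({1..\<nu>} \<rightarrow>\<^sub>E {..nat M})"
      using h_support[of i n] dom[of n] by (simp del: PiE_iff)
  qed (use fin in simp)
  \<comment> \<open>The new head of the chain exceeds the old one by c \<ge> 0; this c becomes the
    new n_1, and the old entries move up one place.\<close>
  also have "\<dots> = (\<Sum>\<^sub>\<infinity>n\<in>{1..\<nu>} \<rightarrow>\<^sub>E UNIV. \<Sum>\<^sub>\<infinity>c\<in>UNIV. h (int c + int (tail_sum \<nu> n 1)) n)"
  proof (rule infsum_cong)
    fix n
    have "h i n = 0" if "i < int (tail_sum \<nu> n 1)" for i
      using h_support[of i n] that by linarith
    hence "(\<Sum>\<^sub>\<infinity>i. h i n) = (\<Sum>\<^sub>\<infinity>i\<in>{int (tail_sum \<nu> n 1)..}. h i n)"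
      by (intro infsum_cong_neutral) auto
    also have "\<dots> = (\<Sum>\<^sub>\<infinity>c. h (int c + int (tail_sum \<nu> n 1)) n)"
      by (rule infsum_reindex_bij_witness[where i = "\<lambda>c. int c + int (tail_sum \<nu> n 1)"
            and j = "\<lambda>i. nat (i - int (tail_sum \<nu> n 1))"]) auto
    finally show "(\<Sum>\<^sub>\<infinity>i. h i n) = \<dots>" .
  qed
  also have "\<dots> = (\<Sum>\<^sub>\<infinity>(n, c)\<in>({1..\<nu>} \<rightarrow>\<^sub>E UNIV) \<times> UNIV. h (int c + int (tail_sum \<nu> n 1)) n)"
  proof (rule infsum_Sigma_finite_support[where C = "({1..\<nu>} \<rightarrow>\<^sub>E {..nat M}) \<times> {..nat M}"])
    fix n c
    assume "n \<in> {1..\<nu>} \<rightarrow>\<^sub>E UNIV" "h (int c + int (tail_sum \<nu> n 1)) n \<noteq> 0"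
    thus "(n, c) \<in> ({1..\<nu>} \<rightarrow>\<^sub>E {..nat M}) \<times> {..nat M}"
      using h_support[of "int c + int (tail_sum \<nu> n 1)" n] dom[of n] by (simp del: PiE_iff)
  qed (use fin in simp)
  also have "\<dots> = (\<Sum>\<^sub>\<infinity>n\<in>{1..Suc \<nu>} \<rightarrow>\<^sub>E UNIV. W (Suc \<nu>) L (tails M (Suc \<nu>) n))"
  proof (rule infsum_reindex_bij_witness[where j = "\<lambda>(n, c). \<lambda>k\<in>{1..Suc \<nu>}. if k = 1 then c else n (k - 1)"
        and i = "\<lambda>n. (\<lambda>k\<in>{1..\<nu>}. n (Suc k), n 1)"])
    fix x :: "(nat \<Rightarrow> nat) \<times> nat"
    assume "x \<in> ({1..\<nu>} \<rightarrow>\<^sub>E UNIV) \<times> UNIV"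
    then obtain n c where x: "x = (n, c)" and n: "n \<in> {1..\<nu>} \<rightarrow>\<^sub>E UNIV" by auto
    define m where "m = (\<lambda>k\<in>{1..Suc \<nu>}. if k = 1 then c else n (k - 1))"
    have "(\<lambda>k\<in>{1..\<nu>}. m (Suc k)) = n"
      by (auto simp: m_def fun_eq_iff PiE_arb[OF n])
    thus "(\<lambda>n. (\<lambda>k\<in>{1..\<nu>}. n (Suc k), n 1)) ((\<lambda>(n, c). \<lambda>k\<in>{1..Suc \<nu>}. if k = 1 then c else n (k - 1)) x) = x"
      unfolding x prod.case m_def[symmetric] by (simp add: m_def)
    show "(\<lambda>(n, c). \<lambda>k\<in>{1..Suc \<nu>}. if k = 1 then c else n (k - 1)) x \<in> {1..Suc \<nu>} \<rightarrow>\<^sub>E UNIV"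
      by (auto simp: x)
    have tail: "tail_sum (Suc \<nu>) m (Suc k) = tail_sum \<nu> n k" if "1 \<le> k" for k
      unfolding tail_sum_def sum.shift_bounds_cl_Suc_ivl m_def by (rule sum.cong) (use that in auto)
    have "tail_sum (Suc \<nu>) m 1 = m 1 + tail_sum (Suc \<nu>) m (Suc 1)"
      unfolding tail_sum_def by (rule sum.atLeast_Suc_atMost) simp
    hence head: "tail_sum (Suc \<nu>) m 1 = c + tail_sum \<nu> n 1"
      unfolding tail[OF order_refl] by (simp add: m_def)
    have "(\<lambda>k. tails M (Suc \<nu>) m (Suc k)) = tails (int c + int (tail_sum \<nu> n 1)) \<nu> n"
      using head by (auto simp: fun_eq_iff tails_def tail)
    hence "W (Suc \<nu>) L (tails M (Suc \<nu>) m) = h (int c + int (tail_sum \<nu> n 1)) n"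
      using head by (simp add: h_def tails_def)
    thus "W (Suc \<nu>) L (tails M (Suc \<nu>) ((\<lambda>(n, c). \<lambda>k\<in>{1..Suc \<nu>}. if k = 1 then c else n (k - 1)) x)) =
        (case x of (n, c) \<Rightarrow> h (int c + int (tail_sum \<nu> n 1)) n)"
      unfolding x prod.case m_def .
  next
    fix n :: "nat \<Rightarrow> nat"
    assume n: "n \<in> {1..Suc \<nu>} \<rightarrow>\<^sub>E UNIV"
    show "(\<lambda>(n, c). \<lambda>k\<in>{1..Suc \<nu>}. if k = 1 then c else n (k - 1)) (\<lambda>k\<in>{1..\<nu>}. n (Suc k), n 1) = n"
      by (auto simp: fun_eq_iff PiE_arb[OF n])
    show "(\<lambda>k\<in>{1..\<nu>}. n (Suc k), n 1) \<in> ({1..\<nu>} \<rightarrow>\<^sub>E UNIV) \<times> UNIV"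
      by auto
  qed
  finally show ?case .
qed

text \<open>The parity condition says that m = i - S - 2k for an integer k, where S is the sum of
  the N_k. Hence the sum over m is a seed at (i - S, n_\<nu>), the innermost factor of
  \<open>W\<close>.\<close>

lemma inner_sum_eq_W:
  assumes "1 \<le> \<nu>"
  shows "(\<Sum>\<^sub>\<infinity>m\<in>{m. (i + m) mod 2 = (\<Sum>k=1..\<nu>. tail_sum \<nu> n k) mod 2}. lhs_term \<nu> L M (p\<^sup>2) (i, m, n)) =
    P powi ((int i)\<^sup>2) * B3 (int L + int M - int i) (int L) * W \<nu> (int i) (tails (int L - int i) \<nu> n)"
proof -
  define N where "N = tail_sum \<nu> n"
  define S where "S = (\<Sum>k=1..\<nu>. N k)"
  define S2 where "S2 = (\<Sum>k=1..\<nu>. (N k)\<^sup>2)"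
  define Pr where "Pr = (\<Prod>j=1..<\<nu>. B3 (int i - (\<Sum>l=1..j. int (N l)) + int (n j)) (int (n j)))"
  define K where "K = P powi ((int i)\<^sup>2) * P powi (int S2) * B3 (int L + int M - int i) (int L) *
     B3 (int L - int (N 1)) (int i) * Pr"
  define h where "h k = p powi ((int i - int S - 2 * k)\<^sup>2) * B1 (3 * int (n \<nu>)) (int i - int S - 2 * k) *
     B3 (2 * int (n \<nu>) + k) k" for k
  define par where "par = {m. (i + m) mod 2 = S mod 2}"
  have cube: "(p\<^sup>2) ^ 3 = P\<^sup>2"
    by (simp add: P_eq flip: power_mult)
  have half: "2 * ((int i - int m - int S) div 2) = int i - int m - int S" if "m \<in> par" for m
  proof -
    have "even (i + m) = even S" using that by (simp add: par_def even_iff_mod_2_eq_zero)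
    hence "even (int i - int m - int S)" by simp
    thus ?thesis by simp
  qed
  have even_S2: "even S2 = even S"
    unfolding S2_def S_def by (rule even_sum_squares)
  have term_eq: "lhs_term \<nu> L M (p\<^sup>2) (i, m, n) = K * h ((int i - int m - int S) div 2)" if m: "m \<in> par" for m
  proof -
    have "even (i + m) = even S" using m by (simp add: par_def even_iff_mod_2_eq_zero)
    hence "even (m\<^sup>2 + 3 * (i\<^sup>2 + S2))" using even_S2 by auto
    hence "(p\<^sup>2) ^ ((m\<^sup>2 + 3 * (i\<^sup>2 + S2)) div 2) = p powi int (m\<^sup>2 + 3 * (i\<^sup>2 + S2))"
      unfolding power_mult[symmetric] power_int_of_nat by simp
    also have "\<dots> = p powi ((int m)\<^sup>2) * P powi ((int i)\<^sup>2) * P powi (int S2)"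
      unfolding p3_powi one.s_powi_add[symmetric] by (rule arg_cong) simp
    finally have pow: "(p\<^sup>2) ^ ((m\<^sup>2 + 3 * (i\<^sup>2 + S2)) div 2) = \<dots>" .
    define k where "k = (int i - int m - int S) div 2"
    have k: "int i - int S - 2 * k = int m" using half[OF m] by (simp add: k_def)
    have sym: "B3 (2 * int (n \<nu>) + k) (2 * int (n \<nu>)) = B3 (2 * int (n \<nu>) + k) k"
      using three.B_sym[of "2 * int (n \<nu>) + k" k] by simp
    have sum_int: "(\<Sum>k=1..\<nu>. int (N k)) = int S"
      by (simp add: S_def)
    show ?thesis
      unfolding lhs_term_def prod.case Let_def N_def[symmetric] S2_def[symmetric] pow cube sum_int
        k_def[symmetric] sym K_def Pr_def h_def k by (simp only: mult_ac)
  qed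
  have "(\<Sum>\<^sub>\<infinity>m\<in>par. lhs_term \<nu> L M (p\<^sup>2) (i, m, n)) = (\<Sum>\<^sub>\<infinity>m\<in>par. K * h ((int i - int m - int S) div 2))"
    by (intro infsum_cong term_eq)
  also have "\<dots> = (\<Sum>\<^sub>\<infinity>k\<in>{k. 2 * k \<le> int i - int S}. K * h k)"
  proof (rule infsum_reindex_bij_witness[where j = "\<lambda>m. (int i - int m - int S) div 2"
        and i = "\<lambda>k. nat (int i - int S - 2 * k)"])
    fix k assume k: "k \<in> {k. 2 * k \<le> int i - int S}"
    define m where "m = nat (int i - int S - 2 * k)"
    have m: "int m = int i - int S - 2 * k" using k by (simp add: m_def)
    show "(int i - int (nat (int i - int S - 2 * k)) - int S) div 2 = k"
      unfolding m_def[symmetric] m by simp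
    have "even (int i + int m) = even (int S)" unfolding m by simp
    thus "nat (int i - int S - 2 * k) \<in> par"
      unfolding m_def[symmetric] by (simp add: par_def mod_2_eq_odd)
  next
    fix m assume m: "m \<in> par"
    show "nat (int i - int S - 2 * ((int i - int m - int S) div 2)) = m"
      unfolding half[OF m] by simp
    show "(int i - int m - int S) div 2 \<in> {k. 2 * k \<le> int i - int S}"
      using half[OF m] by simp
  qed simp
  also have "\<dots> = (\<Sum>\<^sub>\<infinity>k. K * h k)"
    by (rule infsum_cong_neutral) (auto simp: h_def qbinom_def)
  also have "\<dots> = K * seed (int i - int S) (int (n \<nu>))"
    by (simp add: infsum_cmult_right' seed_def h_def)
  also have "\<dots> = P powi ((int i)\<^sup>2) * B3 (int L + int M - int i) (int L) * W \<nu> (int i) (tails (int L - int i) \<nu> n)"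
  proof -
    obtain \<mu> where \<mu>: "\<nu> = Suc \<mu>" using assms by (cases \<nu>) auto
    define t where "t = tails (int L - int i) \<nu> n"
    have t_Suc: "t (Suc k) = int (N (Suc k))" and t_0: "t 0 = int L - int i" for k
      by (simp_all add: t_def tails_def N_def)
    have t_diff: "t (Suc k) - t (Suc (Suc k)) = int (n (Suc k))" if "k < \<mu>" for k
    proof -
      have "tail_sum \<nu> n (Suc k) = n (Suc k) + tail_sum \<nu> n (Suc (Suc k))"
        unfolding tail_sum_def by (rule sum.atLeast_Suc_atMost) (use that \<mu> in simp)
      thus ?thesis by (simp add: t_Suc N_def)
    qed
    have t_last: "t \<nu> = int (n \<nu>)"
      using t_Suc[of \<mu>] by (simp add: \<mu> N_def tail_sum_def)
    \<comment> \<open>The factor j = 0 of the closed form, with N_0 = L - i, is the separate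
      binomial [L - N_1, i] of the theorem.\<close>
    have "B3 (int i + (t 0 - t (Suc 0))) (t 0 - t (Suc 0)) = B3 (int L - int (N 1)) (int i)"
      using three.B_sym[of "int L - int (N 1)" "int i"] by (simp add: t_Suc t_0 algebra_simps)
    moreover have "(\<Prod>j<\<mu>. B3 (int i - (\<Sum>l<Suc j. t (Suc l)) + (t (Suc j) - t (Suc (Suc j)))) (t (Suc j) - t (Suc (Suc j)))) = Pr"
      unfolding Pr_def \<mu> One_nat_def prod.shift_bounds_Suc_ivl atLeast0LessThan sum.atLeast1_atMost_eq
      by (rule prod.cong[OF refl]) (simp only: t_diff lessThan_iff flip: t_Suc)
    ultimately have prod: "(\<Prod>j<\<nu>. B3 (int i - (\<Sum>l<j. t (Suc l)) + (t j - t (Suc j))) (t j - t (Suc j)))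
        = B3 (int L - int (N 1)) (int i) * Pr"
      unfolding \<mu> prod.lessThan_Suc_shift by simp
    have "(\<Sum>k<\<nu>. (t (Suc k))\<^sup>2) = int S2" "(\<Sum>k<\<nu>. t (Suc k)) = int S"
      by (simp_all add: S2_def S_def sum.atLeast1_atMost_eq t_Suc)
    thus ?thesis
      unfolding t_def[symmetric] W_closed_form prod t_last by (simp add: K_def mult_ac)
  qed
  finally show ?thesis
    unfolding par_def S_def N_def .
qed

lemma multisum_eq:
  assumes "1 \<le> \<nu>"
  shows "(\<Sum>\<^sub>\<infinity>x\<in>index_set \<nu>. lhs_term \<nu> L M (p\<^sup>2) x) =
    (\<Sum>\<^sub>\<infinity>i. P powi (i\<^sup>2) * B3 (int L + int M - i) (int L) * V \<nu> i (int L - i))"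
proof -
  define E :: "(nat \<Rightarrow> nat) set" where "E = {1..\<nu>} \<rightarrow>\<^sub>E UNIV"
  define D :: "(nat \<Rightarrow> nat) set" where "D = {1..\<nu>} \<rightarrow>\<^sub>E {..L}"
  define par where "par i n = {m. (i + m) mod 2 = (\<Sum>k=1..\<nu>. tail_sum \<nu> n k) mod 2}" for i n
  define f where "f i n m = lhs_term \<nu> L M (p\<^sup>2) (i, m, n)" for i n m
  have fin: "finite D" unfolding D_def by (intro finite_PiE) auto
  have f_support: "i \<le> L \<and> n \<in> D \<and> m \<le> 3 * L" if n: "n \<in> E" and nz: "f i n m \<noteq> 0" for i n m
  proof -
    have "qbinom (int L - int (tail_sum \<nu> n 1)) (int i) ((p\<^sup>2) ^ 3) \<noteq> 0" "B1 (3 * int (n \<nu>)) (int m) \<noteq> 0"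
      using nz unfolding f_def lhs_term_def prod.case Let_def by force+
    hence b: "i + tail_sum \<nu> n 1 \<le> L" "m \<le> 3 * n \<nu>"
      by (auto simp: qbinom_def split: if_splits)
    have le: "n k \<le> L" if "k \<in> {1..\<nu>}" for k
      using le_tail_sum[of k \<nu> n] that b(1) by linarith
    have "n \<in> D" unfolding D_def
    proof (rule PiE_I)
      show "n k = undefined" if "k \<notin> {1..\<nu>}" for k
        using PiE_arb[OF n[unfolded E_def] that] .
    qed (use le in simp)
    moreover have "m \<le> 3 * L" using b(2) le[of \<nu>] assms by simp
    ultimately show ?thesis using b(1) by simp
  qed
  have "(\<Sum>\<^sub>\<infinity>x\<in>index_set \<nu>. lhs_term \<nu> L M (p\<^sup>2) x) = (\<Sum>\<^sub>\<infinity>((i, n), m)\<in>(SIGMA x:UNIV \<times> E. par (fst x) (snd x)). f i n m)"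
    by (rule infsum_reindex_bij_witness[where j = "\<lambda>(i, m, n). ((i, n), m)" and i = "\<lambda>((i, n), m). (i, m, n)"])
       (auto simp: index_set_def par_def E_def f_def)
  also have "\<dots> = (\<Sum>\<^sub>\<infinity>x\<in>UNIV \<times> E. \<Sum>\<^sub>\<infinity>m\<in>par (fst x) (snd x). f (fst x) (snd x) m)"
    by (subst infsum_Sigma_finite_support[where C = "({..L} \<times> D) \<times> {..3 * L}"])
       (use fin f_support in \<open>auto simp: case_prod_unfold\<close>)
  also have "\<dots> = (\<Sum>\<^sub>\<infinity>(i, n)\<in>UNIV \<times> E. \<Sum>\<^sub>\<infinity>m\<in>par i n. f i n m)"
    by (simp add: case_prod_unfold)
  also have "\<dots> = (\<Sum>\<^sub>\<infinity>i. \<Sum>\<^sub>\<infinity>n\<in>E. \<Sum>\<^sub>\<infinity>m\<in>par i n. f i n m)"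
  proof (rule infsum_Sigma_finite_support[symmetric, where C = "{..L} \<times> D"])
    fix i n assume n: "n \<in> E" and "(\<Sum>\<^sub>\<infinity>m\<in>par i n. f i n m) \<noteq> 0"
    then obtain m where "f i n m \<noteq> 0" by (auto elim: infsum_nonzeroD)
    thus "(i, n) \<in> {..L} \<times> D" using f_support[OF n] by blast
  qed (use fin in simp)
  also have "\<dots> = (\<Sum>\<^sub>\<infinity>i. P powi ((int i)\<^sup>2) * B3 (int L + int M - int i) (int L) * V \<nu> (int i) (int L - int i))"
    unfolding f_def par_def inner_sum_eq_W[OF assms] infsum_cmult_right' E_def V_eq_sum_W ..
  also have "\<dots> = (\<Sum>\<^sub>\<infinity>i\<in>{0..}. P powi (i\<^sup>2) * B3 (int L + int M - i) (int L) * V \<nu> i (int L - i))"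
    by (rule infsum_reindex_bij_witness[where i = nat and j = int]) auto
  also have "\<dots> = (\<Sum>\<^sub>\<infinity>i. P powi (i\<^sup>2) * B3 (int L + int M - i) (int L) * V \<nu> i (int L - i))"
    by (rule infsum_cong_neutral) (auto simp: V_neg)
  finally show ?thesis .
qed

lemma identity_nonzero:
  assumes "1 \<le> \<nu>"
  shows "(\<Sum>\<^sub>\<infinity>x\<in>index_set \<nu>. lhs_term \<nu> L M (p\<^sup>2) x) =
    (\<Sum>\<^sub>\<infinity>j. p\<^sup>2 powi (3 * int ((\<nu> + 2) choose 2) * j\<^sup>2 + j) *
       qtrinom_S (int L) (int M) ((int \<nu> + 2) * j) ((int \<nu> + 1) * j) ((p\<^sup>2) ^ 3))"
proof -
  define \<alpha> where "\<alpha> j = p powi (3 * (int \<nu> + 1) * j\<^sup>2 + 2 * j)" for j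
  define g where "g i j = P powi ((int L - i)\<^sup>2) * B3 (int M + i) (int L) * (\<alpha> j * T3 (int L - i) i ((int \<nu> + 1) * j) j)" for i j
  have "(\<Sum>\<^sub>\<infinity>x\<in>index_set \<nu>. lhs_term \<nu> L M (p\<^sup>2) x) =
      (\<Sum>\<^sub>\<infinity>i. P powi ((int L - i)\<^sup>2) * B3 (int M + i) (int L) * V \<nu> (int L - i) i)"
    unfolding multisum_eq[OF assms]
    \<comment> \<open>Replacing i by L - i produces the left-hand side of
      \<open>S_transform\<close>.\<close>
    using infsum_int_reflect[of "\<lambda>i. P powi (i\<^sup>2) * B3 (int L + int M - i) (int L) * V \<nu> i (int L - i)" "int L"]
    by (simp add: add.commute)
  also have "\<dots> = (\<Sum>\<^sub>\<infinity>i. \<Sum>\<^sub>\<infinity>j. g i j)"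
    unfolding V_eq_T g_def \<alpha>_def infsum_cmult_right' ..
  also have "\<dots> = (\<Sum>\<^sub>\<infinity>j. \<Sum>\<^sub>\<infinity>i. g i j)"
  proof (rule infsum_swap_finite_support[where C = "{0..int L} \<times> {- int L..int L}"])
    fix i j assume "g i j \<noteq> 0"
    hence "T3 (int L - i) i ((int \<nu> + 1) * j) j \<noteq> 0" by (auto simp: g_def)
    from three.T_nonzeroD[OF this] show "(i, j) \<in> {0..int L} \<times> {- int L..int L}" by simp
  qed simp
  also have "\<dots> = (\<Sum>\<^sub>\<infinity>j. \<alpha> j * (\<Sum>\<^sub>\<infinity>i. P powi ((int L - i)\<^sup>2) * B3 (int M + i) (int L) * T3 (int L - i) i ((int \<nu> + 1) * j) j))"
    unfolding infsum_cmult_right'[symmetric] g_def by (simp only: mult_ac)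
  also have "\<dots> = (\<Sum>\<^sub>\<infinity>j. \<alpha> j * (P powi (((int \<nu> + 1) * j)\<^sup>2) *
      qtrinom_S (int L) (int M) ((int \<nu> + 2) * j) ((int \<nu> + 1) * j) (P\<^sup>2)))"
    by (subst three.S_transform) auto
  also have "\<dots> = (\<Sum>\<^sub>\<infinity>j. p\<^sup>2 powi (3 * int ((\<nu> + 2) choose 2) * j\<^sup>2 + j) *
       qtrinom_S (int L) (int M) ((int \<nu> + 2) * j) ((int \<nu> + 1) * j) ((p\<^sup>2) ^ 3))"
  proof (rule infsum_cong)
    fix j
    have "2 * ((\<nu> + 2) choose 2) = (\<nu> + 2) * (\<nu> + 1)"
      by (simp add: choose_two)
    from arg_cong[OF this, of int]
    have "2 * int ((\<nu> + 2) choose 2) = (int \<nu> + 2) * (int \<nu> + 1)"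
      by (simp add: algebra_simps)
    moreover have "2 * (3 * c * j\<^sup>2 + j) = 3 * (2 * c) * j\<^sup>2 + 2 * j" for c :: int
      by simp
    ultimately have "2 * (3 * int ((\<nu> + 2) choose 2) * j\<^sup>2 + j) = 3 * ((int \<nu> + 2) * (int \<nu> + 1)) * j\<^sup>2 + 2 * j"
      by (simp only:)
    also have "\<dots> = 3 * (int \<nu> + 1) * j\<^sup>2 + 2 * j + 3 * ((int \<nu> + 1) * j)\<^sup>2"
      by (simp add: power2_eq_square algebra_simps)
    finally have "p\<^sup>2 powi (3 * int ((\<nu> + 2) choose 2) * j\<^sup>2 + j) = \<alpha> j * P powi (((int \<nu> + 1) * j)\<^sup>2)"
      unfolding one.s2_powi \<alpha>_def p3_powi one.s_powi_add[symmetric] by (rule arg_cong)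
    moreover have "(p\<^sup>2) ^ 3 = P\<^sup>2"
      by (simp add: P_eq flip: power_mult)
    ultimately show "\<alpha> j * (P powi (((int \<nu> + 1) * j)\<^sup>2) *
      qtrinom_S (int L) (int M) ((int \<nu> + 2) * j) ((int \<nu> + 1) * j) (P\<^sup>2)) =
      p\<^sup>2 powi (3 * int ((\<nu> + 2) choose 2) * j\<^sup>2 + j) *
       qtrinom_S (int L) (int M) ((int \<nu> + 2) * j) ((int \<nu> + 1) * j) ((p\<^sup>2) ^ 3)"
      by (simp only: mult.assoc)
  qed
  finally show ?thesis .
qed

end

text \<open>At q = 0 every q-binomial in range is 1 and only terms with exponent 0 survive. That
  leaves the all-zero tuple on the left and j = 0 on the right, so both sides equal 1.\<close>

lemma identity_zero:
  assumes "1 \<le> \<nu>"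
  shows "(\<Sum>\<^sub>\<infinity>x\<in>index_set \<nu>. lhs_term \<nu> L M 0 x) =
    (\<Sum>\<^sub>\<infinity>j. 0 powi (3 * int ((\<nu> + 2) choose 2) * j\<^sup>2 + j) *
       qtrinom_S (int L) (int M) ((int \<nu> + 2) * j) ((int \<nu> + 1) * j) (0 ^ 3))"
proof -
  have B0: "qbinom A k 0 = 1" if "0 \<le> k" "k \<le> A" for A k
    using that by (simp add: qbinom_def qpoch_def)
  define z :: "nat \<Rightarrow> nat" where "z = (\<lambda>k\<in>{1..\<nu>}. 0)"
  have tail_z: "tail_sum \<nu> z k = 0" if "1 \<le> k" for k
    using that by (simp add: tail_sum_def z_def)
  have "(\<Sum>\<^sub>\<infinity>x\<in>index_set \<nu>. lhs_term \<nu> L M 0 x) = lhs_term \<nu> L M 0 (0, 0, z)"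
  proof (rule infsum_single)
    show "(0, 0, z) \<in> index_set \<nu>"
      by (simp add: index_set_def tail_z) (simp add: z_def)
    fix x assume x: "x \<in> index_set \<nu>" "x \<noteq> (0, 0, z)"
    obtain i m n where imn: "x = (i, m, n)" by (cases x)
    define S2 where "S2 = (\<Sum>k=1..\<nu>. (tail_sum \<nu> n k)\<^sup>2)"
    have n: "n \<in> {1..\<nu>} \<rightarrow>\<^sub>E UNIV" and "(i + m) mod 2 = (\<Sum>k=1..\<nu>. tail_sum \<nu> n k) mod 2"
      using x(1) by (auto simp: index_set_def imn)
    hence "even (i + m) = even S2"
      unfolding S2_def even_sum_squares by (simp add: even_iff_mod_2_eq_zero)
    hence ev: "even (m\<^sup>2 + 3 * (i\<^sup>2 + S2))" by auto
    have "m\<^sup>2 + 3 * (i\<^sup>2 + S2) \<noteq> 0"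
    proof
      assume "m\<^sup>2 + 3 * (i\<^sup>2 + S2) = 0"
      hence im: "i = 0" "m = 0" and "S2 = 0" by auto
      hence "tail_sum \<nu> n 1 = 0" using assms by (simp add: S2_def)
      hence "n k = 0" if "k \<in> {1..\<nu>}" for k
        using that by (simp add: tail_sum_def)
      hence "n = z" by (auto simp: z_def fun_eq_iff PiE_arb[OF n])
      thus False using x(2) im by (simp add: imn)
    qed
    hence "(m\<^sup>2 + 3 * (i\<^sup>2 + S2)) div 2 \<noteq> 0" using ev by (metis dvd_mult_div_cancel mult_0_right)
    thus "lhs_term \<nu> L M 0 x = 0"
      unfolding imn lhs_term_def prod.case Let_def S2_def[symmetric] by (simp add: power_0_left)
  qed
  also have "\<dots> = 1"
  proof -
    have "z \<nu> = 0" "\<And>j. j \<in> {1..<\<nu>} \<Longrightarrow> z j = 0" using assms by (auto simp: z_def)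
    thus ?thesis
      unfolding lhs_term_def prod.case Let_def by (simp add: tail_z B0)
  qed
  also have "1 = qtrinom_S (int L) (int M) 0 0 (0 ^ 3)"
    unfolding qtrinom_S_def by (subst infsum_single[where a = 0]) (auto simp: B0)
  also have "\<dots> = (\<Sum>\<^sub>\<infinity>j. 0 powi (3 * int ((\<nu> + 2) choose 2) * j\<^sup>2 + j) *
       qtrinom_S (int L) (int M) ((int \<nu> + 2) * j) ((int \<nu> + 1) * j) (0 ^ 3))"
  proof (subst infsum_single[where a = 0])
    fix j :: int assume "j \<noteq> 0"
    have "3 * int ((\<nu> + 2) choose 2) * j\<^sup>2 + j = j * (3 * (int ((\<nu> + 2) choose 2) * j) + 1)"
      by (simp add: power2_eq_square algebra_simps)
    \<comment> \<open>It is congruent to 1 mod 3.\<close>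
    moreover have "3 * (int ((\<nu> + 2) choose 2) * j) + 1 \<noteq> 0" by presburger
    ultimately have "3 * int ((\<nu> + 2) choose 2) * j\<^sup>2 + j \<noteq> 0" using \<open>j \<noteq> 0\<close> by simp
    thus "0 powi (3 * int ((\<nu> + 2) choose 2) * j\<^sup>2 + j) *
       qtrinom_S (int L) (int M) ((int \<nu> + 2) * j) ((int \<nu> + 1) * j) (0 ^ 3) = 0"
      by simp
  qed auto
  finally show ?thesis .
qed

theorem theorem6p2:
  fixes q :: complex and \<nu> L M :: nat
  assumes "norm q < 1" and "\<nu> \<ge> 1"
  shows "(\<Sum>\<^sub>\<infinity>x\<in>index_set \<nu>. lhs_term \<nu> L M q x) =
         (\<Sum>\<^sub>\<infinity>j::int. q powi (3 * int ((\<nu> + 2) choose 2) * j\<^sup>2 + j)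
            * qtrinom_S (int L) (int M) ((int \<nu> + 2) * j) ((int \<nu> + 1) * j) (q ^ 3))"
proof (cases "q = 0")
  case True
  thus ?thesis using identity_zero[OF assms(2)] by simp
next
  case False
  have "norm (csqrt q) ^ 2 < 1"
    using assms(1) by (simp flip: norm_power)
  then interpret cubic_base "csqrt q" "csqrt q ^ 3"
    by unfold_locales (use False in \<open>auto simp: power_less_one_iff\<close>)
  show ?thesis
    using identity_nonzero[OF assms(2), of L M] by simp
qed

end
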